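(* Let $\Omega$ be a bounded domain in $\mathbb{C}^d$. Let $E \subset \partial\Omega$ be a closed set such that for every $p, q \in \partial\Omega$ with $p\neq q$ there exist $p' \in \partial\Omega$ and $r>0$ satisfying: (a) $p \in B(p',r)$ and $q \in \partial\Omega\setminus\overline{B(p',r)}$; (b) $E\cap\partial B(p',r)=\emptyset$. Further, assume that for every $q'\in\partial\Omega\setminus E$ there exist a neighbourhood $U$ of $q'$ in $\mathbb{C}^d$, a point $z_0\in\Omega$ and a $\mathcal{C}^1$-smooth strictly increasing function $f:(0,\infty)\to\mathbb{R}$, with $f(t)\to\infty$ as $t\to\infty$, such that: (1) for all $z\in\Omega\cap U$, $\mathsf{k}_\Omega(z_0,z)\leq f(1/\delta_\Omega(z))$; (2) $\mathfrak{M}_{\Omega,U}(r)\to 0$ as $r\to 0$; and (3) there exists $r_0>0$ such that $$\int_0^{r_0}\frac{\mathfrak{M}_{\Omega,U}(r)}{r^2}\,f'\!\left(\frac1r\right)dr<\infty.$$ Then $\Omega$ is a visibility domain.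
   Context: $\|\cdot\|$ is the Euclidean norm; $B(x,r)$ is the open Euclidean ball in $\mathbb{C}^d$ with centre $x$ and radius $r$. $\mathbb{D}$ is the open unit disk in $\mathbb{C}$. For a bounded domain $\Omega\subset\mathbb{C}^d$, $\delta_\Omega(z)$ is the Euclidean distance from $z\in\Omega$ to $\partial\Omega$; $\mathsf{k}_\Omega$ is the Kobayashi distance; $\kappa_\Omega(z;v)=\inf\{t>0:\exists\,\phi:\mathbb{D}\to\Omega \text{ holomorphic},\ \phi(0)=z,\ t\phi'(0)=v\}$ is the Kobayashi--Royden metric. For an open set $U\subset\mathbb{C}^d$ with $U\cap\partial\Omega\neq\emptyset$ and $r>0$, $$\mathfrak{M}_{\Omega,U}(r):=\sup\left\{\frac{1}{\kappa_\Omega(z;v)} : z\in U\cap\Omega,\ \delta_\Omega(z)\leq r,\ v\in\mathbb{C}^d,\ \|v\|=1\right\}.$$ For $\lambda\geq1$, $\kappa\geq0$ and an interval $I\subset\mathbb{R}$, a curve $\sigma:I\to\Omega$ is a $(\lambda,\kappa)$-almost-geodesic if (i) for all $s,t\in I$, $\frac1\lambda|t-s|-\kappa\leq\mathsf{k}_\Omega(\sigma(t),\sigma(s))\leq\lambda|t-s|+\kappa$; and (ii) $\sigma$ is absolutely continuous and $\kappa_\Omega(\sigma(t);\sigma'(t))\leq\lambda$ for almost every $t\in I$. For $\lambda\ge 1,\kappa>0$, $\Omega$ is a $(\lambda,\kappa)$-visibility domain if any two distinct points of $\Omega$ can be joined by a $(\lambda,\kappa)$-almost-geodesic and, for every pair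 of points $p\neq q$ in $\partial\Omega$, there exist $\mathbb{C}^d$-neighbourhoods $V$ of $p$ and $W$ of $q$ with $\overline V\cap\overline W=\emptyset$ and a compact set $K\subset\Omega$ such that every $(\lambda,\kappa)$-almost-geodesic in $\Omega$ with initial point in $V$ and terminal point in $W$ intersects $K$. $\Omega$ is a visibility domain if it is a $(\lambda,\kappa)$-visibility domain for every $\lambda\geq1$ and every $\kappa>0$. *)

theory Defs
  imports "HOL-Complex_Analysis.Complex_Analysis"
begin

text \<open>
  The space \<open>\<complex>\<^sup>d\<close> is \<open>complex ^ 'd\<close>, whose \<open>norm\<close>, \<open>dist\<close> and \<open>ball\<close> are the Euclidean ones.
  The library has no holomorphy for maps into this type, so it is required componentwise.
\<close>

definition analytic_disc :: "(complex ^ 'd) set \<Rightarrow> (complex \<Rightarrow> complex ^ 'd) \<Rightarrow> bool" where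
  "analytic_disc \<Omega> \<phi> \<longleftrightarrow>
     (\<forall>i. (\<lambda>\<zeta>. \<phi> \<zeta> $ i) holomorphic_on ball 0 1) \<and> \<phi> ` ball 0 1 \<subseteq> \<Omega>"

definition disc_deriv :: "(complex \<Rightarrow> complex ^ 'd) \<Rightarrow> complex \<Rightarrow> complex ^ 'd" where
  "disc_deriv \<phi> \<zeta> = (\<chi> i. deriv (\<lambda>\<xi>. \<phi> \<xi> $ i) \<zeta>)"

definition kobayashi_royden :: "(complex ^ 'd) set \<Rightarrow> complex ^ 'd \<Rightarrow> complex ^ 'd \<Rightarrow> real" where
  "kobayashi_royden \<Omega> z v =
     Inf {t. t > 0 \<and> (\<exists>\<phi>. analytic_disc \<Omega> \<phi> \<and> \<phi> 0 = z \<and> t *\<^sub>R disc_deriv \<phi> 0 = v)}"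

text \<open>
  The Poincare distance of the unit disc, normalised so that its infinitesimal metric
  \<open>\<bar>v\<bar> / (1 - \<bar>z\<bar>\<^sup>2)\<close> is the Kobayashi--Royden metric of the disc as normalised above.
\<close>

definition poincare_dist :: "complex \<Rightarrow> complex \<Rightarrow> real" where
  "poincare_dist a b = artanh (norm ((a - b) / (1 - cnj b * a)))"

text \<open>
  Kobayashi's definition: the infimum, over chains of \<open>n\<close> analytic discs from \<open>x\<close> to \<open>y\<close>, of the
  total Poincare length.  The \<open>j\<close>-th disc carries \<open>a j\<close> to \<open>p j\<close> and \<open>b j\<close> to \<open>p (Suc j)\<close>.
\<close>

definition kobayashi_dist :: "(complex ^ 'd) set \<Rightarrow> complex ^ 'd \<Rightarrow> complex ^ 'd \<Rightarrow> real" where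
  "kobayashi_dist \<Omega> x y =
     Inf {(\<Sum>j<n. poincare_dist (a j) (b j)) | (n::nat) p \<phi> a b.
            p 0 = x \<and> p n = y \<and>
            (\<forall>j<n. analytic_disc \<Omega> (\<phi> j) \<and> a j \<in> ball 0 1 \<and> b j \<in> ball 0 1 \<and>
                   \<phi> j (a j) = p j \<and> \<phi> j (b j) = p (Suc j))}"

definition bdist :: "(complex ^ 'd) set \<Rightarrow> complex ^ 'd \<Rightarrow> real" where
  "bdist \<Omega> z = infdist z (frontier \<Omega>)"

text \<open>
  For bounded \<open>\<Omega>\<close>, open \<open>U\<close> meeting \<open>frontier \<Omega>\<close> and \<open>r > 0\<close> the set below is nonempty and
  bounded above, so the real-valued \<open>Sup\<close> is the genuine supremum.
\<close>

definition M_fun :: "(complex ^ 'd) set \<Rightarrow> (complex ^ 'd) set \<Rightarrow> real \<Rightarrow> real" where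
  "M_fun \<Omega> U r =
     Sup {1 / kobayashi_royden \<Omega> z v | z v. z \<in> U \<inter> \<Omega> \<and> bdist \<Omega> z \<le> r \<and> norm v = 1}"

text \<open>Absolute continuity of a curve; the library's \<open>absolutely_continuous\<close> is about measures.\<close>

definition abs_cont_on :: "real set \<Rightarrow> (real \<Rightarrow> 'a::real_normed_vector) \<Rightarrow> bool" where
  "abs_cont_on I \<sigma> \<longleftrightarrow>
     (\<forall>\<epsilon>>0. \<exists>\<delta>>0. \<forall>(n::nat) a b.
        (\<forall>i<n. a i \<in> I \<and> b i \<in> I \<and> a i \<le> b i) \<and>
        disjoint_family_on (\<lambda>i. {a i<..<b i}) {..<n} \<and>
        (\<Sum>i<n. b i - a i) < \<delta>
        \<longrightarrow> (\<Sum>i<n. norm (\<sigma> (b i) - \<sigma> (a i))) < \<epsilon>)"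

definition almost_geodesic ::
  "(complex ^ 'd) set \<Rightarrow> real \<Rightarrow> real \<Rightarrow> real set \<Rightarrow> (real \<Rightarrow> complex ^ 'd) \<Rightarrow> bool" where
  "almost_geodesic \<Omega> L \<kappa> I \<sigma> \<longleftrightarrow>
     is_interval I \<and> \<sigma> ` I \<subseteq> \<Omega> \<and>
     (\<forall>s\<in>I. \<forall>t\<in>I.
        (1 / L) * \<bar>t - s\<bar> - \<kappa> \<le> kobayashi_dist \<Omega> (\<sigma> t) (\<sigma> s) \<and>
        kobayashi_dist \<Omega> (\<sigma> t) (\<sigma> s) \<le> L * \<bar>t - s\<bar> + \<kappa>) \<and>
     abs_cont_on I \<sigma> \<and>
     (AE t in lebesgue. t \<in> I \<longrightarrow>
        (\<exists>v. (\<sigma> has_vector_derivative v) (at t within I) \<and> kobayashi_royden \<Omega> (\<sigma> t) v \<le> L))"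

definition visibility_domain_wrt :: "real \<Rightarrow> real \<Rightarrow> (complex ^ 'd) set \<Rightarrow> bool" where
  "visibility_domain_wrt L \<kappa> \<Omega> \<longleftrightarrow>
     (\<forall>x\<in>\<Omega>. \<forall>y\<in>\<Omega>. x \<noteq> y \<longrightarrow>
        (\<exists>a b \<sigma>. a \<le> b \<and> almost_geodesic \<Omega> L \<kappa> {a..b} \<sigma> \<and> \<sigma> a = x \<and> \<sigma> b = y)) \<and>
     (\<forall>p\<in>frontier \<Omega>. \<forall>q\<in>frontier \<Omega>. p \<noteq> q \<longrightarrow>
        (\<exists>V W K. open V \<and> p \<in> V \<and> open W \<and> q \<in> W \<and> closure V \<inter> closure W = {} \<and>
           compact K \<and> K \<subseteq> \<Omega> \<and>
           (\<forall>a b \<sigma>. a \<le> b \<and> almost_geodesic \<Omega> L \<kappa> {a..b} \<sigma> \<and> \<sigma> a \<in> V \<and> \<sigma> b \<in> W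
              \<longrightarrow> \<sigma> ` {a..b} \<inter> K \<noteq> {})))"

definition visibility_domain :: "(complex ^ 'd) set \<Rightarrow> bool" where
  "visibility_domain \<Omega> \<longleftrightarrow> (\<forall>L\<ge>1. \<forall>\<kappa>>0. visibility_domain_wrt L \<kappa> \<Omega>)"

end

theory Submission
  imports Defs
begin

text \<open>
  Existence of almost-geodesics: a chain of discs whose Poincare length exceeds the Kobayashi distance
  of its endpoints by less than \<open>\<kappa>\<close>, traversed along the hyperbolic geodesics of the discs at unit
  speed, is already a \<open>(1, \<kappa>)\<close>-almost-geodesic. In particular Royden's theorem, that the Kobayashi
  distance is the integrated form of the Kobayashi--Royden metric, is not needed.

  Visibility: if almost-geodesics from \<open>p\<close> to \<open>q\<close> left every compact set, they would accumulate at a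
  boundary point off \<open>E\<close> on the sphere separating \<open>p\<close> from \<open>q\<close>, and near that point contain arcs
  \<open>\<sigma>\<close> of diameter bounded below with \<open>\<delta>(\<sigma>(t))\<close> uniformly small. Let \<open>\<delta>(\<sigma>(t))\<close> be maximal at \<open>t = c\<close>.
  Going through \<open>z\<^sub>0\<close>, the bound by \<open>f\<close> gives \<open>\<bar>t - c\<bar> / \<lambda> - \<kappa> \<le> 2 f(1/\<delta>(\<sigma>(t)))\<close>, while
  \<open>\<parallel>\<sigma>'(t)\<parallel> \<le> \<lambda> M(\<delta>(\<sigma>(t)))\<close>. Integrating the speed and substituting
  \<open>\<bar>t - c\<bar> = \<lambda>(2 f(1/r) + \<kappa>)\<close> bounds the length of \<open>\<sigma>\<close> for large \<open>\<bar>t - c\<bar>\<close> by a tail of the integral in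
  (3), and for bounded \<open>\<bar>t - c\<bar>\<close> by a multiple of \<open>M\<close> at a small radius.
\<close>

unbundle no fps_syntax

section \<open>Componentwise norms and derivatives in \<open>'a ^ 'd\<close>\<close>

lemma norm_vec_le_sum: "norm x \<le> (\<Sum>i\<in>UNIV. norm (x $ i))"
  by (simp add: norm_vec_def L2_set_le_sum)

text \<open>The difference quotient converges as soon as its components do. This matches
  \<open>analytic_disc\<close>, where holomorphy is imposed componentwise.\<close>

lemma has_vector_derivative_vec:
  fixes \<sigma> :: "real \<Rightarrow> 'a::real_normed_vector ^ 'd"
  assumes "\<And>i. ((\<lambda>t. \<sigma> t $ i) has_vector_derivative v $ i) (at t)"
  shows "(\<sigma> has_vector_derivative v) (at t)"
  unfolding has_vector_derivative_def has_derivative_def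
proof
  show "bounded_linear (\<lambda>x. x *\<^sub>R v)"
    by (rule bounded_linear_scaleR_left)
  show "((\<lambda>y. (\<sigma> y - \<sigma> (netlimit (at t)) - (y - netlimit (at t)) *\<^sub>R v) /\<^sub>R norm (y - netlimit (at t))) \<longlongrightarrow> 0) (at t)"
  proof (rule vec_tendstoI)
    fix i
    show "((\<lambda>y. ((\<sigma> y - \<sigma> (netlimit (at t)) - (y - netlimit (at t)) *\<^sub>R v) /\<^sub>R norm (y - netlimit (at t))) $ i) \<longlongrightarrow> 0 $ i) (at t)"
      using assms[of i] unfolding has_vector_derivative_def has_derivative_def by simp
  qed
qed

subsection \<open>Chains of analytic discs\<close>

text \<open>The chains over which \<open>kobayashi_dist\<close> takes its infimum, with the total
  Poincare length as an index. Discs are appended at the far end, so rule induction replaces work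
  with the sequences \<open>p\<close>, \<open>\<phi>\<close>, \<open>a\<close>,
  \<open>b\<close>.\<close>

inductive disc_chain :: "(complex ^ 'd) set \<Rightarrow> complex ^ 'd \<Rightarrow> complex ^ 'd \<Rightarrow> real \<Rightarrow> bool"
  for \<Omega> where
  disc_chain_refl: "disc_chain \<Omega> x x 0"
| disc_chain_step: "\<lbrakk>disc_chain \<Omega> x y l; analytic_disc \<Omega> \<phi>; a \<in> ball 0 1; b \<in> ball 0 1; \<phi> a = y\<rbrakk>
     \<Longrightarrow> disc_chain \<Omega> x (\<phi> b) (l + poincare_dist a b)"

lemma disc_chain_iff:
  "disc_chain \<Omega> x y l \<longleftrightarrow>
     (\<exists>(n::nat) p \<phi> a b. l = (\<Sum>j<n. poincare_dist (a j) (b j)) \<and>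
            p 0 = x \<and> p n = y \<and>
            (\<forall>j<n. analytic_disc \<Omega> (\<phi> j) \<and> a j \<in> ball 0 1 \<and> b j \<in> ball 0 1 \<and>
                   \<phi> j (a j) = p j \<and> \<phi> j (b j) = p (Suc j)))" (is "_ \<longleftrightarrow> ?R y l")
proof
  assume "disc_chain \<Omega> x y l"
  then show "?R y l"
  proof induction
    case (disc_chain_refl x)
    show ?case by (rule exI[of _ 0], rule exI[of _ "\<lambda>_. x"]) simp
  next
    case (disc_chain_step x y l \<psi> \<alpha> \<beta>)
    then obtain n p \<phi> a b where n: "l = (\<Sum>j<n. poincare_dist (a j) (b j))" "p 0 = x" "p n = y"
      "\<forall>j<n. analytic_disc \<Omega> (\<phi> j) \<and> a j \<in> ball 0 1 \<and> b j \<in> ball 0 1 \<and>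
                   \<phi> j (a j) = p j \<and> \<phi> j (b j) = p (Suc j)"
      by blast
    show ?case
      \<comment> \<open>The new disc gets index \<open>n\<close>, while the new endpoint is the
        point with index \<open>Suc n\<close>.\<close>
      apply (rule exI[of _ "Suc n"], rule exI[of _ "p(Suc n := \<psi> \<beta>)"], rule exI[of _ "\<phi>(n := \<psi>)"],
          rule exI[of _ "a(n := \<alpha>)"], rule exI[of _ "b(n := \<beta>)"])
      using n disc_chain_step by (auto simp: less_Suc_eq)
  qed
next
  assume "?R y l"
  then obtain n p \<phi> a b where n: "l = (\<Sum>j<n. poincare_dist (a j) (b j))" "p 0 = x" "p n = y"
      "\<forall>j<n. analytic_disc \<Omega> (\<phi> j) \<and> a j \<in> ball 0 1 \<and> b j \<in> ball 0 1 \<and>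
                   \<phi> j (a j) = p j \<and> \<phi> j (b j) = p (Suc j)"
      by blast
  then show "disc_chain \<Omega> x y l"
  proof (induction n arbitrary: y l)
    case 0
    then show ?case by (auto intro: disc_chain_refl)
  next
    case (Suc n)
    have "disc_chain \<Omega> x (p n) (\<Sum>j<n. poincare_dist (a j) (b j))"
      by (rule Suc.IH) (use Suc.prems in auto)
    from disc_chain_step[OF this, of "\<phi> n" "a n" "b n"] Suc.prems show ?case
      by auto
  qed
qed

lemma kobayashi_dist_eq: "kobayashi_dist \<Omega> x y = Inf {l. disc_chain \<Omega> x y l}"
  unfolding kobayashi_dist_def disc_chain_iff by (rule arg_cong[of _ _ Inf]) blast

text \<open>The second chain is the first premise because the induction runs over it: its discs are
  appended one at a time to the first chain.\<close>

lemma disc_chain_trans: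
  assumes "disc_chain \<Omega> y z m" "disc_chain \<Omega> x y l"
  shows "disc_chain \<Omega> x z (l + m)"
  using assms
proof (induction arbitrary: l)
  case (disc_chain_step y z m \<phi> a b)
  then show ?case
    using disc_chain.disc_chain_step[of \<Omega> x z "l + m" \<phi> a b] by (simp add: add.assoc)
qed simp

lemma poincare_dist_commute: "poincare_dist a b = poincare_dist b a"
proof -
  have "norm (1 - cnj b * a) = norm (1 - cnj a * b)"
    by (subst complex_mod_cnj[symmetric]) (simp add: mult.commute)
  then show ?thesis
    by (simp add: poincare_dist_def norm_divide norm_minus_commute)
qed

lemma disc_chain_disc:
  assumes "analytic_disc \<Omega> \<phi>" "a \<in> ball 0 1" "b \<in> ball 0 1"
  shows "disc_chain \<Omega> (\<phi> a) (\<phi> b) (poincare_dist a b)"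
  using disc_chain_step[OF disc_chain_refl assms] by simp

lemma disc_chain_sym:
  assumes "disc_chain \<Omega> x y l"
  shows "disc_chain \<Omega> y x l"
  using assms
proof induction
  case (disc_chain_step x y l \<phi> a b)
  have "disc_chain \<Omega> (\<phi> b) y (poincare_dist a b)"
    using disc_chain_disc[of \<Omega> \<phi> b a] disc_chain_step by (simp add: poincare_dist_commute)
  from disc_chain_trans[OF disc_chain_step.IH this] show ?case
    by (simp add: add.commute)
qed (rule disc_chain_refl)

section \<open>Moebius transformations and nonnegativity of the Poincare distance\<close>

lemma one_minus_cnj_mult_nonzero:
  assumes "norm a < 1" "norm b < 1"
  shows "1 + cnj a * b \<noteq> 0"
proof
  assume "1 + cnj a * b = 0"
  then have "cnj a * b = - 1"
    by (simp add: add_eq_0_iff)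
  then have "norm a * norm b = 1"
    by (metis complex_mod_cnj norm_minus_cancel norm_mult norm_one)
  moreover have "norm a * norm b \<le> norm a"
    using assms by (simp add: mult_left_le)
  ultimately show False using assms by linarith
qed

text \<open>Rests on the identity
  \<open>|1 + cnj a * z|^2 - |z + a|^2 = (1 - |a|^2) * (1 - |z|^2)\<close>, which is verified over
  the complex numbers, where a squared norm is a product with the conjugate.\<close>

lemma norm_moebius_less_1:
  fixes a z :: complex
  assumes "norm a < 1" "norm z < 1"
  shows "norm ((z + a) / (1 + cnj a * z)) < 1"
proof -
  have nz: "1 + cnj a * z \<noteq> 0"
    by (rule one_minus_cnj_mult_nonzero[OF assms])
  have "complex_of_real ((norm (1 + cnj a * z))\<^sup>2 - (norm (z + a))\<^sup>2)
      = complex_of_real ((1 - (norm a)\<^sup>2) * (1 - (norm z)\<^sup>2))"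
    unfolding of_real_diff of_real_mult of_real_1 complex_norm_square
    by (simp add: algebra_simps)
  then have "(norm (1 + cnj a * z))\<^sup>2 - (norm (z + a))\<^sup>2 = (1 - (norm a)\<^sup>2) * (1 - (norm z)\<^sup>2)"
    using of_real_eq_iff by blast
  moreover have "(1 - (norm a)\<^sup>2) * (1 - (norm z)\<^sup>2) > 0"
    using assms by (intro mult_pos_pos) (simp_all add: power_less_one_iff abs_square_less_1)
  ultimately have "(norm (z + a))\<^sup>2 < (norm (1 + cnj a * z))\<^sup>2"
    by linarith
  then have "norm (z + a) < norm (1 + cnj a * z)"
    by (rule power_less_imp_less_base) simp
  then show ?thesis
    using nz by (simp add: norm_divide divide_simps)
qed

lemma artanh_nonneg:
  fixes x :: real
  assumes "0 \<le> x" "x < 1"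
  shows "0 \<le> artanh x"
proof -
  have "(1 + x) / (1 - x) \<ge> 1"
    using assms by (simp add: divide_simps)
  then show ?thesis
    by (simp add: artanh_def)
qed

lemma poincare_quotient_less_1:
  assumes "a \<in> ball 0 1" "b \<in> ball 0 1"
  shows "norm ((a - b) / (1 - cnj b * a)) < 1"
proof -
  have "norm ((a + - b) / (1 + cnj (- b) * a)) < 1"
    by (rule norm_moebius_less_1) (use assms in simp_all)
  then show ?thesis
    by (simp only: complex_cnj_minus mult_minus_left diff_conv_add_uminus)
qed

lemma poincare_dist_nonneg:
  assumes "a \<in> ball 0 1" "b \<in> ball 0 1"
  shows "poincare_dist a b \<ge> 0"
  using poincare_quotient_less_1[OF assms] unfolding poincare_dist_def
  by (intro artanh_nonneg) auto

lemma disc_chain_nonneg: "disc_chain \<Omega> x y l \<Longrightarrow> l \<ge> 0"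
proof (induction rule: disc_chain.induct)
  case (disc_chain_step x y l \<phi> a b)
  then show ?case
    using poincare_dist_nonneg[of a b] by simp
qed simp

lemma kobayashi_dist_le: "disc_chain \<Omega> x y l \<Longrightarrow> kobayashi_dist \<Omega> x y \<le> l"
  unfolding kobayashi_dist_eq
  by (rule cInf_lower) (auto intro!: bdd_belowI[of _ 0] dest: disc_chain_nonneg)

section \<open>Affine discs and existence of chains in a domain\<close>

lemma norm_vector_scale:
  fixes v :: "complex ^ 'd"
  shows "norm (c *s v) = norm c * norm v"
proof -
  have "norm (c *s v) = L2_set (\<lambda>i. norm c * norm (v $ i)) UNIV"
    by (simp only: norm_vec_def vector_smult_component norm_mult)
  also have "\<dots> = norm c * norm v"
    by (simp only: norm_vec_def L2_set_right_distrib[OF norm_ge_zero])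
  finally show ?thesis .
qed

lemma analytic_disc_affine:
  assumes "ball z e \<subseteq> \<Omega>" "norm v < e"
  shows "analytic_disc \<Omega> (\<lambda>\<zeta>. z + \<zeta> *s v)"
  unfolding analytic_disc_def
proof
  show "\<forall>i. (\<lambda>\<zeta>. (z + \<zeta> *s v) $ i) holomorphic_on ball 0 1"
    unfolding vector_add_component vector_smult_component
    by (intro allI holomorphic_intros)
  show "(\<lambda>\<zeta>. z + \<zeta> *s v) ` ball 0 1 \<subseteq> \<Omega>"
  proof (rule image_subsetI)
    fix \<zeta> :: complex assume "\<zeta> \<in> ball 0 1"
    then have "norm \<zeta> * norm v \<le> norm v"
      by (intro mult_left_le_one_le) auto
    also note assms(2)
    finally have "z + \<zeta> *s v \<in> ball z e"
      by (simp add: dist_norm norm_vector_scale)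
    then show "z + \<zeta> *s v \<in> \<Omega>" using assms(1) by blast
  qed
qed
text \<open>Being joined by a chain is an equivalence relation, and affine discs show that its
  classes are open; connectedness leaves only one class.\<close>

lemma disc_chain_exists:
  assumes "open \<Omega>" "connected \<Omega>" "x \<in> \<Omega>" "y \<in> \<Omega>"
  shows "\<exists>l. disc_chain \<Omega> x y l"
proof (rule connected_equivalence_relation[OF assms(2-4), where R = "\<lambda>x y. \<exists>l. disc_chain \<Omega> x y l"])
  fix x y assume "\<exists>l. disc_chain \<Omega> x y l"
  then show "\<exists>l. disc_chain \<Omega> y x l"
    using disc_chain_sym by blast
next
  fix x y z assume "\<exists>l. disc_chain \<Omega> x y l" "\<exists>l. disc_chain \<Omega> y z l"
  then show "\<exists>l. disc_chain \<Omega> x z l"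
    using disc_chain_trans by blast
next
  fix a assume "a \<in> \<Omega>"
  then obtain e where e: "e > 0" "ball a e \<subseteq> \<Omega>"
    using assms(1) openE by blast
  show "\<exists>T. openin (top_of_set \<Omega>) T \<and> a \<in> T \<and> (\<forall>x\<in>T. \<exists>l. disc_chain \<Omega> a x l)"
  proof (rule exI[of _ "ball a (e/2)"], intro conjI ballI)
    show "openin (top_of_set \<Omega>) (ball a (e/2))"
    proof (rule open_subset)
      have "ball a (e/2) \<subseteq> ball a e" using e(1) by (intro subset_ball) simp
      then show "ball a (e/2) \<subseteq> \<Omega>" using e(2) by blast
    qed simp
    show "a \<in> ball a (e/2)" using e by simp
    fix x assume x: "x \<in> ball a (e/2)"
    \<comment> \<open>The factor 2 places \<open>x\<close> at parameter \<open>1/2\<close> of the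
      affine disc through \<open>a\<close>, inside the open unit disc; \<open>norm v < e\<close> is
      why \<open>x\<close> is taken in the ball of radius \<open>e/2\<close>.\<close>
    define v where "v = 2 *\<^sub>R (x - a)"
    have "norm v < e"
      using x by (simp add: v_def dist_norm norm_minus_commute)
    from disc_chain_disc[OF analytic_disc_affine[OF e(2) this], of 0 "1/2"]
    have "disc_chain \<Omega> (a + 0 *s v) (a + (1/2) *s v) (poincare_dist 0 (1/2))"
      by simp
    moreover have "a + 0 *s v = a" "a + (1/2) *s v = x"
      by (simp_all add: v_def vec_eq_iff scaleR_conv_of_real)
    ultimately show "\<exists>l. disc_chain \<Omega> a x l" by auto
  qed
qed

lemma disc_chain_less:
  assumes "open \<Omega>" "connected \<Omega>" "x \<in> \<Omega>" "y \<in> \<Omega>" "kobayashi_dist \<Omega> x y < c"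
  shows "\<exists>l<c. disc_chain \<Omega> x y l"
proof -
  have "{l. disc_chain \<Omega> x y l} \<noteq> {}" using disc_chain_exists[OF assms(1-4)] by auto
  from cInf_lessD[OF this] show ?thesis using assms(5) unfolding kobayashi_dist_eq by auto
qed

lemma kobayashi_dist_commute: "kobayashi_dist \<Omega> x y = kobayashi_dist \<Omega> y x"
  unfolding kobayashi_dist_eq by (rule arg_cong[of _ _ Inf]) (auto intro: disc_chain_sym)

text \<open>Concatenate two chains, each within \<open>e/2\<close> of its infimum. Such chains exist
  because in a domain the infimum runs over a nonempty set.\<close>

lemma kobayashi_dist_triangle:
  assumes "open \<Omega>" "connected \<Omega>" "x \<in> \<Omega>" "y \<in> \<Omega>" "z \<in> \<Omega>"
  shows "kobayashi_dist \<Omega> x z \<le> kobayashi_dist \<Omega> x y + kobayashi_dist \<Omega> y z"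
proof (rule field_le_epsilon)
  fix e :: real assume "e > 0"
  obtain l where l: "l < kobayashi_dist \<Omega> x y + e/2" "disc_chain \<Omega> x y l"
    using disc_chain_less[OF assms(1,2,3,4), of "kobayashi_dist \<Omega> x y + e/2"] \<open>e > 0\<close> by auto
  obtain m where m: "m < kobayashi_dist \<Omega> y z + e/2" "disc_chain \<Omega> y z m"
    using disc_chain_less[OF assms(1,2,4,5), of "kobayashi_dist \<Omega> y z + e/2"] \<open>e > 0\<close> by auto
  have "kobayashi_dist \<Omega> x z \<le> l + m"
    by (rule kobayashi_dist_le) (rule disc_chain_trans[OF m(2) l(2)])
  then show "kobayashi_dist \<Omega> x z \<le> kobayashi_dist \<Omega> x y + kobayashi_dist \<Omega> y z + e"
    using l(1) m(1) by linarith
qed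

subsection \<open>The Kobayashi--Royden metric of a bounded domain\<close>

definition competitors :: "(complex ^ 'd) set \<Rightarrow> complex ^ 'd \<Rightarrow> complex ^ 'd \<Rightarrow> real set" where
  "competitors \<Omega> z v = {t. t > 0 \<and> (\<exists>\<phi>. analytic_disc \<Omega> \<phi> \<and> \<phi> 0 = z \<and> t *\<^sub>R disc_deriv \<phi> 0 = v)}"

lemma kobayashi_royden_le: "t \<in> competitors \<Omega> z v \<Longrightarrow> kobayashi_royden \<Omega> z v \<le> t"
  unfolding kobayashi_royden_def competitors_def[symmetric]
  by (rule cInf_lower) (auto intro!: bdd_belowI[of _ 0] simp: competitors_def)

text \<open>Cauchy's estimate on the circle of radius \<open>1/2\<close> bounds each component of
  the derivative by \<open>2 * R\<close>; summing the components bounds the norm.\<close>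

lemma disc_deriv_bounded:
  fixes \<Omega> :: "(complex ^ 'd) set"
  assumes "bounded \<Omega>"
  obtains C where "C > 0" "\<And>\<phi>. analytic_disc \<Omega> \<phi> \<Longrightarrow> norm (disc_deriv \<phi> 0) \<le> C"
proof -
  obtain R where R: "R > 0" "\<And>x. x \<in> \<Omega> \<Longrightarrow> norm x \<le> R"
    using assms bounded_pos by blast
  have "norm (disc_deriv \<phi> 0) \<le> real CARD('d) * (2 * R)" if \<phi>: "analytic_disc \<Omega> \<phi>" for \<phi>
  proof -
    have "norm (disc_deriv \<phi> 0 $ i) \<le> 2 * R" for i
    proof -
      have "norm ((deriv ^^ 1) (\<lambda>\<xi>. \<phi> \<xi> $ i) 0) \<le> fact 1 * R / (1/2) ^ 1"
      proof (rule Cauchy_inequality)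
        have h: "(\<lambda>\<xi>. \<phi> \<xi> $ i) holomorphic_on ball 0 1"
          using \<phi> by (simp add: analytic_disc_def)
        show "(\<lambda>\<xi>. \<phi> \<xi> $ i) holomorphic_on ball 0 (1/2)"
          by (rule holomorphic_on_subset[OF h]) auto
        show "continuous_on (cball 0 (1/2)) (\<lambda>\<xi>. \<phi> \<xi> $ i)"
          by (rule continuous_on_subset[OF holomorphic_on_imp_continuous_on[OF h]]) auto
        fix x :: complex assume "norm (0 - x) = 1/2"
        then have "\<phi> x \<in> \<Omega>" using \<phi> by (auto simp: analytic_disc_def image_subset_iff)
        then show "norm (\<phi> x $ i) \<le> R" by (rule order_trans[OF Finite_Cartesian_Product.norm_nth_le R(2)])
      qed simp
      then show ?thesis by (simp add: disc_deriv_def)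
    qed
    then have "(\<Sum>i\<in>UNIV. norm (disc_deriv \<phi> 0 $ i)) \<le> real CARD('d) * (2 * R)"
      using sum_bounded_above[of UNIV "\<lambda>i. norm (disc_deriv \<phi> 0 $ i)" "2 * R"] by simp
    then show ?thesis by (rule order_trans[OF norm_vec_le_sum])
  qed
  then show ?thesis using that[of "real CARD('d) * (2 * R)"] R by simp
qed

lemma competitors_nonempty:
  fixes \<Omega> :: "(complex ^ 'd) set"
  assumes "open \<Omega>" "z \<in> \<Omega>"
  shows "competitors \<Omega> z v \<noteq> {}"
proof -
  obtain e where e: "e > 0" "ball z e \<subseteq> \<Omega>"
    using assms openE by blast
  \<comment> \<open>The summand 1 keeps the quotient meaningful for \<open>v = 0\<close> and makes
    the inequality \<open>c * norm v < e\<close> strict.\<close>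
  define c where "c = e / (norm v + 1)"
  have c: "c > 0" "c * norm v < e" 
  proof -
    have p: "norm v + 1 > 0" using norm_ge_zero[of v] by linarith
    then show "c > 0" using e(1) by (simp add: c_def)
    have "c * norm v < c * (norm v + 1)" using \<open>c > 0\<close> by simp
    also have "\<dots> = e" using p by (simp add: c_def)
    finally show "c * norm v < e" .
  qed
  define w where "w = c *\<^sub>R v"
  have "norm w < e"
    using c by (simp add: w_def)
  then have "analytic_disc \<Omega> (\<lambda>\<zeta>. z + \<zeta> *s w)"
    by (rule analytic_disc_affine[OF e(2)])
  moreover have "z + 0 *s w = z"
    by (simp add: vec_eq_iff)
  moreover have "(1 / c) *\<^sub>R disc_deriv (\<lambda>\<zeta>. z + \<zeta> *s w) 0 = v"
  proof -
    have "deriv (\<lambda>\<xi>. (z + \<xi> *s w) $ i) 0 = w $ i" for i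
      unfolding vector_add_component vector_smult_component
      by (rule DERIV_imp_deriv) (auto intro!: derivative_eq_intros)
    then show ?thesis using c by (simp add: disc_deriv_def vec_eq_iff w_def)
  qed
  ultimately have "1 / c \<in> competitors \<Omega> z v" using c by (auto simp: competitors_def intro!: exI[of _ "\<lambda>\<zeta>. z + \<zeta> *s w"])
  then show ?thesis by blast
qed

text \<open>Every competitor \<open>t\<close> satisfies
  \<open>norm v = t * norm (disc_deriv \<phi> 0)\<close>, and the second factor is at most
  \<open>C\<close>. The bound makes the metric positive on nonzero vectors and bounds the set in
  \<open>M_fun\<close>.\<close>

lemma kobayashi_royden_lower:
  fixes \<Omega> :: "(complex ^ 'd) set"
  assumes "open \<Omega>" "bounded \<Omega>"
  obtains C where "C > 0" "\<And>z v. z \<in> \<Omega> \<Longrightarrow> norm v \<le> C * kobayashi_royden \<Omega> z v"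
proof -
  obtain C where C: "C > 0" "\<And>\<phi>. analytic_disc \<Omega> \<phi> \<Longrightarrow> norm (disc_deriv \<phi> 0) \<le> C"
    using disc_deriv_bounded[OF assms(2)] by blast
  have "norm v \<le> C * kobayashi_royden \<Omega> z v" if z: "z \<in> \<Omega>" for z v
  proof -
    have "norm v / C \<le> Inf (competitors \<Omega> z v)"
    proof (rule cInf_greatest[OF competitors_nonempty[OF assms(1) z]])
      fix t assume "t \<in> competitors \<Omega> z v"
      then obtain \<phi> where t: "t > 0" "analytic_disc \<Omega> \<phi>" "t *\<^sub>R disc_deriv \<phi> 0 = v"
        by (auto simp: competitors_def)
      then have "norm v = t * norm (disc_deriv \<phi> 0)" by force
      also have "\<dots> \<le> t * C" using t C by simp
      finally show "norm v / C \<le> t" using C by (simp add: field_simps)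
    qed
    then show ?thesis
      using C by (simp add: kobayashi_royden_def competitors_def field_simps)
  qed
  with C(1) that show ?thesis by blast
qed

text \<open>Multiplication by \<open>c\<close> carries competitors for \<open>v\<close> to
  competitors for \<open>c *\<^sub>R v\<close>, which gives one inequality; the other is the same
  inequality for \<open>1/c\<close>.\<close>

lemma kobayashi_royden_scale:
  fixes \<Omega> :: "(complex ^ 'd) set"
  assumes "open \<Omega>" "z \<in> \<Omega>" "c > 0"
  shows "kobayashi_royden \<Omega> z (c *\<^sub>R v) = c * kobayashi_royden \<Omega> z v"
proof -
  have le: "kobayashi_royden \<Omega> z (c *\<^sub>R v) \<le> c * kobayashi_royden \<Omega> z v"
    if "c > 0" for c and v :: "complex ^ 'd"
  proof -
    have "kobayashi_royden \<Omega> z (c *\<^sub>R v) / c \<le> Inf (competitors \<Omega> z v)"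
    proof (rule cInf_greatest[OF competitors_nonempty[OF assms(1,2)]])
      fix t assume "t \<in> competitors \<Omega> z v"
      then have "c * t \<in> competitors \<Omega> z (c *\<^sub>R v)"
        using \<open>c > 0\<close> by (auto simp: competitors_def)
      from kobayashi_royden_le[OF this] show "kobayashi_royden \<Omega> z (c *\<^sub>R v) / c \<le> t"
        using \<open>c > 0\<close> by (simp add: field_simps)
    qed
    then show ?thesis
      using \<open>c > 0\<close> by (simp add: kobayashi_royden_def competitors_def field_simps)
  qed
  have "kobayashi_royden \<Omega> z ((1/c) *\<^sub>R (c *\<^sub>R v)) \<le> (1/c) * kobayashi_royden \<Omega> z (c *\<^sub>R v)"
    using assms(3) by (intro le) simp
  then have "c * kobayashi_royden \<Omega> z v \<le> kobayashi_royden \<Omega> z (c *\<^sub>R v)"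
    using assms(3) by (simp add: field_simps)
  with le[OF assms(3), of v] show ?thesis by simp
qed

subsection \<open>Almost-geodesics from chains of discs\<close>

lemma analytic_disc_compose:
  assumes "analytic_disc \<Omega> \<phi>" "m holomorphic_on ball 0 1" "m ` ball 0 1 \<subseteq> ball 0 1"
  shows "analytic_disc \<Omega> (\<lambda>\<zeta>. \<phi> (m \<zeta>))"
  unfolding analytic_disc_def
proof (intro conjI allI)
  fix i
  have "((\<lambda>\<zeta>. \<phi> \<zeta> $ i) \<circ> m) holomorphic_on ball 0 1"
    using assms by (intro holomorphic_on_compose_gen[of _ _ _ "ball 0 1"]) (auto simp: analytic_disc_def)
  then show "(\<lambda>\<zeta>. \<phi> (m \<zeta>) $ i) holomorphic_on ball 0 1"
    by (simp add: o_def)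
  show "(\<lambda>\<zeta>. \<phi> (m \<zeta>)) ` ball 0 1 \<subseteq> \<Omega>"
    using assms by (auto simp: analytic_disc_def image_subset_iff)
qed

text \<open>The inner map is the rotation by \<open>u\<close> followed by the disc automorphism that
  carries 0 to \<open>a\<close>.\<close>

lemma analytic_disc_moebius:
  assumes "analytic_disc \<Omega> \<phi>" "norm a < 1" "norm u = 1"
  shows "analytic_disc \<Omega> (\<lambda>\<zeta>. \<phi> ((u * \<zeta> + a) / (1 + cnj a * (u * \<zeta>))))"
proof (rule analytic_disc_compose[OF assms(1)])
  show "(\<lambda>\<zeta>. (u * \<zeta> + a) / (1 + cnj a * (u * \<zeta>))) holomorphic_on ball 0 1"
  proof (intro holomorphic_intros)
    fix \<zeta> :: complex assume "\<zeta> \<in> ball 0 1"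
    then show "1 + cnj a * (u * \<zeta>) \<noteq> 0"
      using assms by (intro one_minus_cnj_mult_nonzero) (simp_all add: norm_mult)
  qed
  show "(\<lambda>\<zeta>. (u * \<zeta> + a) / (1 + cnj a * (u * \<zeta>))) ` ball 0 1 \<subseteq> ball 0 1"
  proof (rule image_subsetI)
    fix \<zeta> :: complex assume "\<zeta> \<in> ball 0 1"
    then have "norm ((u * \<zeta> + a) / (1 + cnj a * (u * \<zeta>))) < 1"
      using assms by (intro norm_moebius_less_1) (simp_all add: norm_mult)
    then show "(u * \<zeta> + a) / (1 + cnj a * (u * \<zeta>)) \<in> ball 0 1" by simp
  qed
qed

section \<open>Hyperbolic geodesics of the disc, parametrised by \<open>tanh\<close>\<close>

lemma tanh_artanh_real:
  fixes x :: real
  assumes "\<bar>x\<bar> < 1"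
  shows "tanh (artanh x) = x"
proof -
  define y where "y = (1 + x) / (1 - x)"
  have y: "y > 0" using assms by (simp add: y_def)
  have "artanh x = ln (sqrt y)"
    using y by (simp add: artanh_def y_def ln_sqrt)
  then have "tanh (artanh x) = (y - 1) / (y + 1)"
    using y by (simp add: tanh_ln_real)
  also have "\<dots> = x"
    using assms by (simp add: y_def divide_simps)
  finally show ?thesis .
qed

text \<open>Reparametrises the disc by an automorphism carrying 0 to \<open>a\<close> and a point of
  the nonnegative real axis to \<open>b\<close>, so that the geodesic from \<open>a\<close> to
  \<open>b\<close> becomes a segment of the real diameter.\<close>

lemma analytic_disc_normalise:
  assumes "analytic_disc \<Omega> \<phi>" "a \<in> ball 0 1" "b \<in> ball 0 1"
  obtains \<psi> where "analytic_disc \<Omega> \<psi>" "\<psi> 0 = \<phi> a" "\<psi> (of_real (tanh (poincare_dist a b))) = \<phi> b"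
proof -
  \<comment> \<open>\<open>\<beta>\<close> is the image of \<open>b\<close> under the automorphism
    carrying \<open>a\<close> to 0.\<close>
  define \<beta> where "\<beta> = (b - a) / (1 - cnj a * b)"
  have a: "norm a < 1" and b: "norm b < 1" using assms by auto
  have \<beta>: "norm \<beta> < 1"
    using poincare_quotient_less_1[OF assms(3,2)] by (simp only: \<beta>_def)
  have pd: "poincare_dist a b = artanh (norm \<beta>)"
    by (subst poincare_dist_commute) (simp only: poincare_dist_def \<beta>_def)
  have t: "tanh (poincare_dist a b) = norm \<beta>"
    unfolding pd using \<beta> by (intro tanh_artanh_real) simp
  \<comment> \<open>The rotation carrying \<open>norm \<beta>\<close> to \<open>\<beta>\<close>; for
    \<open>\<beta> = 0\<close> any unimodular number would serve.\<close>
  define u where "u = (if \<beta> = 0 then 1 else \<beta> / norm \<beta>)"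
  have u: "norm u = 1" "u * norm \<beta> = \<beta>"
    by (auto simp: u_def norm_divide)
  have nz: "1 + cnj (- a) * b \<noteq> 0"
    using a b by (intro one_minus_cnj_mult_nonzero) simp_all
  have nza: "1 + cnj (- a) * a \<noteq> 0"
    using a by (intro one_minus_cnj_mult_nonzero) simp_all
  have "\<beta> + a = b * (1 - cnj a * a) / (1 - cnj a * b)"
    using nz by (simp add: \<beta>_def divide_simps) (simp add: algebra_simps)
  moreover have "1 + cnj a * \<beta> = (1 - cnj a * a) / (1 - cnj a * b)"
    using nz by (simp add: \<beta>_def divide_simps) (simp add: algebra_simps)
  ultimately have m: "(\<beta> + a) / (1 + cnj a * \<beta>) = b"
    using nz nza by simp
  show ?thesis
  proof (rule that[OF analytic_disc_moebius[OF assms(1) a u(1)]])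
    show "\<phi> ((u * complex_of_real (tanh (poincare_dist a b)) + a)
       / (1 + cnj a * (u * complex_of_real (tanh (poincare_dist a b))))) = \<phi> b"
      unfolding t u(2) m ..
  qed simp
qed

lemma tanh_in_disc: "complex_of_real (tanh t) \<in> ball 0 1"
  using tanh_real_bounds[of t] by (simp add: abs_less_iff)

text \<open>By the addition formula for \<open>tanh\<close> the Moebius quotient equals
  \<open>tanh (s - t)\<close>. Hence \<open>tanh\<close> runs through the real diameter at unit
  hyperbolic speed.\<close>

lemma poincare_dist_tanh: "poincare_dist (of_real (tanh s)) (of_real (tanh t)) = \<bar>t - s\<bar>"
proof -
  have "tanh (s - t) = (tanh s - tanh t) / (1 - tanh s * tanh t)"
    using tanh_add[of s "-t"] by simp
  then have "(of_real (tanh s) - of_real (tanh t)) / (1 - cnj (of_real (tanh t)) * of_real (tanh s))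
      = complex_of_real (tanh (s - t))"
    by (simp add: mult.commute)
  then have "poincare_dist (of_real (tanh s)) (of_real (tanh t)) = artanh \<bar>tanh (s - t)\<bar>"
    unfolding poincare_dist_def by (simp only: norm_of_real)
  also have "\<dots> = \<bar>s - t\<bar>"
    by (simp only: tanh_real_abs[symmetric] artanh_tanh_real)
  finally show ?thesis by (simp only: abs_minus_commute)
qed

text \<open>The geodesic through \<open>\<psi> 0\<close> is, up to a disc automorphism, centred at any of its points.\<close>

lemma disc_geodesic_derivative:
  assumes "analytic_disc \<Omega> \<psi>"
  obtains \<eta> where "analytic_disc \<Omega> \<eta>" "\<eta> 0 = \<psi> (of_real (tanh t))"
    "((\<lambda>s. \<psi> (of_real (tanh s))) has_vector_derivative disc_deriv \<eta> 0) (at t)"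
proof -
  define \<tau> where "\<tau> = complex_of_real (tanh t)"
  define \<eta> where "\<eta> = (\<lambda>\<zeta>. \<psi> ((1 * \<zeta> + \<tau>) / (1 + cnj \<tau> * (1 * \<zeta>))))"
  have an: "analytic_disc \<Omega> \<eta>"
    unfolding \<eta>_def by (rule analytic_disc_moebius[OF assms]) (use tanh_in_disc[of t] in \<open>auto simp: \<tau>_def\<close>)
  have eq: "\<psi> (of_real (tanh s)) = \<eta> (of_real (tanh (s - t)))" for s
  proof -
    have "tanh s = (tanh (s - t) + tanh t) / (1 + tanh t * tanh (s - t))"
      using tanh_add[of "s - t" t] by (simp add: mult.commute)
    then have "complex_of_real (tanh s) = (1 * complex_of_real (tanh (s - t)) + \<tau>) / (1 + cnj \<tau> * (1 * complex_of_real (tanh (s - t))))"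
      by (simp add: \<tau>_def)
    then show ?thesis by (simp only: \<eta>_def)
  qed
  have "((\<lambda>s. \<eta> (of_real (tanh (s - t)))) has_vector_derivative disc_deriv \<eta> 0) (at t)"
  proof (rule has_vector_derivative_vec)
    fix i
    have g: "((\<lambda>s. complex_of_real (tanh (s - t))) has_vector_derivative 1) (at t)"
    proof -
      have "((\<lambda>s. tanh (s - t)) has_real_derivative 1) (at t)"
        by (auto intro!: derivative_eq_intros)
      from has_vector_derivative_of_real[OF this] show ?thesis by simp
    qed
    have "(\<lambda>\<zeta>. \<eta> \<zeta> $ i) holomorphic_on ball 0 1"
      using an by (simp add: analytic_disc_def)
    then have "((\<lambda>\<zeta>. \<eta> \<zeta> $ i) has_field_derivative deriv (\<lambda>\<zeta>. \<eta> \<zeta> $ i) 0) (at (complex_of_real (tanh (t - t))))"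
      using holomorphic_derivI[of "\<lambda>\<zeta>. \<eta> \<zeta> $ i" "ball 0 1" 0] by simp
    from field_vector_diff_chain_at[OF g this]
    show "((\<lambda>s. \<eta> (of_real (tanh (s - t))) $ i) has_vector_derivative disc_deriv \<eta> 0 $ i) (at t)"
      by (simp add: o_def disc_deriv_def)
  qed
  then have "((\<lambda>s. \<psi> (of_real (tanh s))) has_vector_derivative disc_deriv \<eta> 0) (at t)"
    by (simp only: eq)
  moreover have "\<eta> 0 = \<psi> (of_real (tanh t))" by (simp add: \<eta>_def \<tau>_def)
  ultimately show ?thesis using that an by blast
qed

lemma kobayashi_royden_disc:
  assumes "analytic_disc \<Omega> \<eta>"
  shows "kobayashi_royden \<Omega> (\<eta> 0) (disc_deriv \<eta> 0) \<le> 1"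
  using assms by (intro kobayashi_royden_le) (auto simp: competitors_def intro!: exI[of _ \<eta>])

text \<open>Joins unit-speed geodesic arcs, one for each disc. \<open>F\<close> collects the
  junction times, where a corner may occur. The last clause says that every subarc is spanned by a
  chain exactly as long as its time interval, which bounds the Kobayashi distance of its
  ends.\<close>

lemma disc_chain_curve:
  assumes "disc_chain \<Omega> x y l" "x \<in> \<Omega>"
  shows "\<exists>\<sigma> F. finite F \<and> \<sigma> 0 = x \<and> \<sigma> l = y \<and> \<sigma> ` {0..l} \<subseteq> \<Omega> \<and>
    (\<forall>t\<in>{0<..<l} - F. \<exists>v. (\<sigma> has_vector_derivative v) (at t) \<and> kobayashi_royden \<Omega> (\<sigma> t) v \<le> 1) \<and>
    (\<forall>s t. 0 \<le> s \<longrightarrow> s \<le> t \<longrightarrow> t \<le> l \<longrightarrow> disc_chain \<Omega> (\<sigma> s) (\<sigma> t) (t - s))"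
  using assms
proof induction
  case (disc_chain_refl x)
  show ?case
  proof (rule exI[of _ "\<lambda>_. x"], rule exI[of _ "{}"], intro conjI allI impI)
    fix s t :: real assume "0 \<le> s" "s \<le> t" "t \<le> 0"
    then have "t - s = 0" by linarith
    then show "disc_chain \<Omega> x x (t - s)" by (simp only: disc_chain.disc_chain_refl)
  qed (use disc_chain_refl in auto)
next
  case (disc_chain_step x y l \<phi> a b)
  then obtain \<sigma> F where \<sigma>: "finite F" "\<sigma> 0 = x" "\<sigma> l = y" "\<sigma> ` {0..l} \<subseteq> \<Omega>"
    "\<And>t. t \<in> {0<..<l} - F \<Longrightarrow> \<exists>v. (\<sigma> has_vector_derivative v) (at t) \<and> kobayashi_royden \<Omega> (\<sigma> t) v \<le> 1"
    "\<And>s t. 0 \<le> s \<Longrightarrow> s \<le> t \<Longrightarrow> t \<le> l \<Longrightarrow> disc_chain \<Omega> (\<sigma> s) (\<sigma> t) (t - s)"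
    by blast
  define m where "m = poincare_dist a b"
  have m: "m \<ge> 0" unfolding m_def by (rule poincare_dist_nonneg) fact+
  have l: "l \<ge> 0" using disc_chain_nonneg disc_chain_step by blast
  obtain \<psi> where \<psi>: "analytic_disc \<Omega> \<psi>" "\<psi> 0 = \<phi> a" "\<psi> (of_real (tanh m)) = \<phi> b"
    using analytic_disc_normalise[OF disc_chain_step.hyps(2,3,4)] unfolding m_def by blast
  \<comment> \<open>The new arc is shifted so as to start at time \<open>l\<close>, where the curve
    built so far ends.\<close>
  define \<gamma> where "\<gamma> = (\<lambda>t. \<psi> (complex_of_real (tanh (t - l))))"
  define \<rho> where "\<rho> = (\<lambda>t. if t \<le> l then \<sigma> t else \<gamma> t)"
  have \<gamma>l: "\<gamma> l = \<sigma> l" using \<psi> \<sigma> disc_chain_step by (simp add: \<gamma>_def)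
  have chain\<gamma>: "disc_chain \<Omega> (\<gamma> s) (\<gamma> t) (t - s)" if "s \<le> t" for s t
    using disc_chain_disc[OF \<psi>(1) tanh_in_disc tanh_in_disc, of "s - l" "t - l"] that
    by (simp add: poincare_dist_tanh \<gamma>_def)
  have \<gamma>\<Omega>: "\<gamma> t \<in> \<Omega>" for t
    using \<psi>(1) tanh_in_disc[of "t - l"] unfolding analytic_disc_def \<gamma>_def by blast
  have \<gamma>': "\<exists>v. (\<gamma> has_vector_derivative v) (at t) \<and> kobayashi_royden \<Omega> (\<gamma> t) v \<le> 1" for t
  proof -
    obtain \<eta> where \<eta>: "analytic_disc \<Omega> \<eta>" "\<eta> 0 = \<psi> (of_real (tanh (t - l)))"
      "((\<lambda>s. \<psi> (of_real (tanh s))) has_vector_derivative disc_deriv \<eta> 0) (at (t - l))"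
      using disc_geodesic_derivative[OF \<psi>(1)] by blast
    have "((\<lambda>s. s - l) has_vector_derivative 1) (at t)"
      by (auto intro!: derivative_eq_intros)
    from vector_diff_chain_at[OF this \<eta>(3)] have "(\<gamma> has_vector_derivative disc_deriv \<eta> 0) (at t)"
      by (simp add: o_def \<gamma>_def)
    with kobayashi_royden_disc[OF \<eta>(1)] \<eta>(2) show ?thesis by (auto simp: \<gamma>_def)
  qed
  show ?case unfolding m_def[symmetric]
  proof (rule exI[of _ \<rho>], rule exI[of _ "insert l F"], intro conjI ballI allI impI)
    show "finite (insert l F)" using \<sigma> by simp
    show "\<rho> 0 = x" using \<sigma> l by (simp add: \<rho>_def)
    show "\<rho> (l + m) = \<phi> b"
    \<comment> \<open>For \<open>m = 0\<close> the time \<open>l + m\<close> still belongs to the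
      branch \<open>\<sigma>\<close>; the two points agree because
      \<open>tanh 0 = 0\<close>.\<close>
    proof (cases "m = 0")
      case True
      then show ?thesis using \<psi> \<sigma> disc_chain_step by (simp add: \<rho>_def)
    next
      case False
      then show ?thesis using \<psi> m by (simp add: \<rho>_def \<gamma>_def)
    qed
    show "\<rho> ` {0..l + m} \<subseteq> \<Omega>"
    proof (rule image_subsetI)
      fix t assume t: "t \<in> {0..l + m}"
      show "\<rho> t \<in> \<Omega>"
      proof (cases "t \<le> l")
        case True
        then have "t \<in> {0..l}" using t by simp
        then show ?thesis using \<sigma>(4) True by (auto simp: \<rho>_def)
      qed (simp add: \<rho>_def \<gamma>\<Omega>)
    qed
  next
    fix t assume t: "t \<in> {0<..<l + m} - insert l F"
    show "\<exists>v. (\<rho> has_vector_derivative v) (at t) \<and> kobayashi_royden \<Omega> (\<rho> t) v \<le> 1"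
    proof (cases "t < l")
      case True
      then obtain v where v: "(\<sigma> has_vector_derivative v) (at t)" "kobayashi_royden \<Omega> (\<sigma> t) v \<le> 1"
        using \<sigma>(5)[of t] t by auto
      have "(\<rho> has_vector_derivative v) (at t)"
        by (rule has_vector_derivative_transform_within_open[OF v(1), of "{..<l}"]) (use True in \<open>auto simp: \<rho>_def\<close>)
      then show ?thesis using v True by (auto simp: \<rho>_def)
    next
      case False
      then have tl: "l < t" using t by auto
      obtain v where v: "(\<gamma> has_vector_derivative v) (at t)" "kobayashi_royden \<Omega> (\<gamma> t) v \<le> 1"
        using \<gamma>' by blast
      have "(\<rho> has_vector_derivative v) (at t)"
        by (rule has_vector_derivative_transform_within_open[OF v(1), of "{l<..}"]) (use tl in \<open>auto simp: \<rho>_def\<close>)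
      then show ?thesis using v tl by (auto simp: \<rho>_def)
    qed
  next
    fix s t assume st: "0 \<le> s" "s \<le> t" "t \<le> l + m"
    consider "t \<le> l" | "s \<le> l" "l < t" | "l < s" by linarith
    then show "disc_chain \<Omega> (\<rho> s) (\<rho> t) (t - s)"
    proof cases
      case 1
      then show ?thesis using \<sigma>(6)[of s t] st by (simp add: \<rho>_def)
    next
      case 2
      \<comment> \<open>A subarc across the junction splits there, at
        \<open>\<gamma> l = \<sigma> l\<close>, and the lengths \<open>l - s\<close> and
        \<open>t - l\<close> add up.\<close>
      have "disc_chain \<Omega> (\<sigma> s) (\<gamma> t) ((l - s) + (t - l))"
        by (rule disc_chain_trans[of _ "\<gamma> l"]) (use 2 st chain\<gamma>[of l t] \<sigma>(6)[of s l] \<gamma>l in auto)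
      then show ?thesis using 2 by (simp add: \<rho>_def)
    next
      case 3
      then show ?thesis using chain\<gamma>[of s t] st by (simp add: \<rho>_def)
    qed
  qed
qed

text \<open>Recentring a disc at any point of its geodesic expresses the velocity there as a
  derivative at 0, so the Euclidean speed is at most the constant of
  \<open>disc_deriv_bounded\<close>. The mean value inequality bounds each arc, and the chain
  follows by the triangle inequality.\<close>

lemma disc_chain_dist_le:
  assumes "bounded \<Omega>"
  obtains C where "C > 0" "\<And>x y l. disc_chain \<Omega> x y l \<Longrightarrow> dist x y \<le> C * l"
proof -
  obtain C where C: "C > 0" "\<And>\<phi>. analytic_disc \<Omega> \<phi> \<Longrightarrow> norm (disc_deriv \<phi> 0) \<le> C"
    using disc_deriv_bounded[OF assms] by blast
  have "dist x y \<le> C * l" if "disc_chain \<Omega> x y l" for x y l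
    using that
  proof induction
    case (disc_chain_step x y l \<phi> a b)
    define m where "m = poincare_dist a b"
    have m: "m \<ge> 0" unfolding m_def by (rule poincare_dist_nonneg) fact+
    obtain \<psi> where \<psi>: "analytic_disc \<Omega> \<psi>" "\<psi> 0 = \<phi> a" "\<psi> (of_real (tanh m)) = \<phi> b"
      using analytic_disc_normalise[OF disc_chain_step.hyps(2,3,4)] unfolding m_def by blast
    have "\<exists>v. ((\<lambda>s. \<psi> (of_real (tanh s))) has_vector_derivative v) (at t) \<and> norm v \<le> C" for t
      using disc_geodesic_derivative[OF \<psi>(1), of t] C(2) by metis
    then obtain v where v: "\<And>t. ((\<lambda>s. \<psi> (of_real (tanh s))) has_vector_derivative v t) (at t)" "\<And>t. norm (v t) \<le> C"
      by metis
    have "norm (\<psi> (of_real (tanh m)) - \<psi> (of_real (tanh 0))) \<le> C * norm (m - 0)"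
    proof (rule differentiable_bound[of UNIV])
      fix t :: real
      show "((\<lambda>s. \<psi> (of_real (tanh s))) has_derivative (\<lambda>h. h *\<^sub>R v t)) (at t within UNIV)"
        using v(1)[of t] by (simp add: has_vector_derivative_def)
      show "onorm (\<lambda>h. h *\<^sub>R v t) \<le> C"
        using v(2)[of t] by (intro onorm_le) (simp add: mult.commute[of C] mult_left_mono)
    qed auto
    then have "dist y (\<phi> b) \<le> C * m"
      using m \<psi> disc_chain_step by (simp add: dist_norm norm_minus_commute)
    then have "dist x (\<phi> b) \<le> C * l + C * m"
      using disc_chain_step.IH dist_triangle[of x "\<phi> b" y] by linarith
    then show ?case by (simp add: m_def distrib_left)
  qed simp
  with C(1) that show ?thesis by blast
qed

lemma lipschitz_imp_abs_cont_on:
  assumes "\<And>s t. s \<in> I \<Longrightarrow> t \<in> I \<Longrightarrow> s \<le> t \<Longrightarrow> norm (\<sigma> t - \<sigma> s) \<le> C * (t - s)" "C > 0"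
  shows "abs_cont_on I \<sigma>"
  unfolding abs_cont_on_def
proof (intro allI impI)
  fix \<epsilon> :: real assume \<epsilon>: "\<epsilon> > 0"
  show "\<exists>\<delta>>0. \<forall>(n::nat) a b.
        (\<forall>i<n. a i \<in> I \<and> b i \<in> I \<and> a i \<le> b i) \<and>
        disjoint_family_on (\<lambda>i. {a i<..<b i}) {..<n} \<and>
        (\<Sum>i<n. b i - a i) < \<delta>
        \<longrightarrow> (\<Sum>i<n. norm (\<sigma> (b i) - \<sigma> (a i))) < \<epsilon>"
  proof (rule exI[of _ "\<epsilon> / C"], intro conjI allI impI)
    show "\<epsilon> / C > 0" using \<epsilon> assms by simp
    fix n :: nat and a b
    assume *: "(\<forall>i<n. a i \<in> I \<and> b i \<in> I \<and> a i \<le> b i) \<and>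
        disjoint_family_on (\<lambda>i. {a i<..<b i}) {..<n} \<and> (\<Sum>i<n. b i - a i) < \<epsilon> / C"
    then have "(\<Sum>i<n. norm (\<sigma> (b i) - \<sigma> (a i))) \<le> (\<Sum>i<n. C * (b i - a i))"
      using assms(1) by (intro sum_mono) simp
    also have "\<dots> = C * (\<Sum>i<n. b i - a i)" by (rule sum_distrib_left[symmetric])
    also have "\<dots> < \<epsilon>" using * assms(2) by (simp add: pos_less_divide_eq mult.commute)
    finally show "(\<Sum>i<n. norm (\<sigma> (b i) - \<sigma> (a i))) < \<epsilon>" .
  qed
qed

text \<open>A chain whose length is within \<open>\<kappa>\<close> of the infimum is traversed at Kobayashi speed at most 1; by
  the triangle inequality no subarc can then be shorter than its parameter length by more than \<open>\<kappa>\<close>.\<close>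

lemma almost_geodesic_exists:
  fixes \<Omega> :: "(complex ^ 'd) set"
  assumes \<Omega>: "open \<Omega>" "connected \<Omega>" "bounded \<Omega>" and xy: "x \<in> \<Omega>" "y \<in> \<Omega>"
    and L: "L \<ge> 1" and \<kappa>: "\<kappa> > 0"
  shows "\<exists>a b \<sigma>. a \<le> b \<and> almost_geodesic \<Omega> L \<kappa> {a..b} \<sigma> \<and> \<sigma> a = x \<and> \<sigma> b = y"
proof -
  obtain l where l: "l < kobayashi_dist \<Omega> x y + \<kappa>" "disc_chain \<Omega> x y l"
    using disc_chain_less[OF \<Omega>(1,2) xy, of "kobayashi_dist \<Omega> x y + \<kappa>"] \<kappa> by auto
  have l0: "l \<ge> 0" using disc_chain_nonneg[OF l(2)] .
  obtain \<sigma> F where \<sigma>: "finite F" "\<sigma> 0 = x" "\<sigma> l = y" "\<sigma> ` {0..l} \<subseteq> \<Omega>"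
    "\<And>t. t \<in> {0<..<l} - F \<Longrightarrow> \<exists>v. (\<sigma> has_vector_derivative v) (at t) \<and> kobayashi_royden \<Omega> (\<sigma> t) v \<le> 1"
    "\<And>s t. 0 \<le> s \<Longrightarrow> s \<le> t \<Longrightarrow> t \<le> l \<Longrightarrow> disc_chain \<Omega> (\<sigma> s) (\<sigma> t) (t - s)"
    using disc_chain_curve[OF l(2) xy(1)] by blast
  have in\<Omega>: "\<sigma> t \<in> \<Omega>" if "0 \<le> t" "t \<le> l" for t using \<sigma>(4) that by auto
  have upper: "kobayashi_dist \<Omega> (\<sigma> s) (\<sigma> t) \<le> t - s" if "0 \<le> s" "s \<le> t" "t \<le> l" for s t
    by (rule kobayashi_dist_le[OF \<sigma>(6)[OF that]])
  have lower: "t - s - \<kappa> \<le> kobayashi_dist \<Omega> (\<sigma> s) (\<sigma> t)" if "0 \<le> s" "s \<le> t" "t \<le> l" for s t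
  proof -
    have "kobayashi_dist \<Omega> x y \<le> kobayashi_dist \<Omega> x (\<sigma> s) + kobayashi_dist \<Omega> (\<sigma> s) y"
      using that by (intro kobayashi_dist_triangle \<Omega> xy in\<Omega>) auto
    moreover have "kobayashi_dist \<Omega> (\<sigma> s) y \<le> kobayashi_dist \<Omega> (\<sigma> s) (\<sigma> t) + kobayashi_dist \<Omega> (\<sigma> t) y"
      using that by (intro kobayashi_dist_triangle \<Omega> xy in\<Omega>) auto
    moreover have "kobayashi_dist \<Omega> x (\<sigma> s) \<le> s" "kobayashi_dist \<Omega> (\<sigma> t) y \<le> l - t"
      using upper[of 0 s] upper[of t l] that \<sigma>(2,3) by auto
    ultimately show ?thesis using l(1) by linarith
  qed
  have both: "(1 / L) * \<bar>t - s\<bar> - \<kappa> \<le> kobayashi_dist \<Omega> (\<sigma> t) (\<sigma> s) \<and>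
        kobayashi_dist \<Omega> (\<sigma> t) (\<sigma> s) \<le> L * \<bar>t - s\<bar> + \<kappa>"
    if "s \<in> {0..l}" "t \<in> {0..l}" for s t
  proof -
    define d where "d = kobayashi_dist \<Omega> (\<sigma> t) (\<sigma> s)"
    have "\<bar>t - s\<bar> - \<kappa> \<le> d" "d \<le> \<bar>t - s\<bar>"
      using upper[of s t] lower[of s t] upper[of t s] lower[of t s] that
        kobayashi_dist_commute[of \<Omega> "\<sigma> t" "\<sigma> s"]
      unfolding d_def by (cases "s \<le> t"; force)+
    moreover define e where "e = \<bar>t - s\<bar>"
    moreover have "(1 / L) * \<bar>t - s\<bar> \<le> 1 * \<bar>t - s\<bar>"
      using L by (intro mult_right_mono) auto
    moreover have "1 * \<bar>t - s\<bar> \<le> L * \<bar>t - s\<bar>"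
      using L by (intro mult_right_mono) auto
    ultimately have "(1 / L) * e - \<kappa> \<le> d \<and> d \<le> L * e + \<kappa>"
      using \<kappa> by fastforce
    then show ?thesis by (simp add: d_def e_def)
  qed
  obtain C where C: "C > 0" "\<And>x y l. disc_chain \<Omega> x y l \<Longrightarrow> dist x y \<le> C * l"
    using disc_chain_dist_le[OF \<Omega>(3)] by blast
  have ac: "abs_cont_on {0..l} \<sigma>"
  proof (rule lipschitz_imp_abs_cont_on[OF _ C(1)])
    fix s t assume "s \<in> {0..l}" "t \<in> {0..l}" "s \<le> t"
    then have "dist (\<sigma> s) (\<sigma> t) \<le> C * (t - s)"
      by (intro C(2) \<sigma>(6)) auto
    then show "norm (\<sigma> t - \<sigma> s) \<le> C * (t - s)"
      by (simp add: dist_norm norm_minus_commute)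
  qed
  have ae: "AE t in lebesgue. t \<in> {0..l} \<longrightarrow>
        (\<exists>v. (\<sigma> has_vector_derivative v) (at t within {0..l}) \<and> kobayashi_royden \<Omega> (\<sigma> t) v \<le> L)"
  proof (rule AE_I')
    \<comment> \<open>Junction times and both endpoints are excluded, since
      \<open>disc_chain_curve\<close> gives derivatives only at interior times off \<open>F\<close>;
      a finite set is null.\<close>
    show "F \<union> {0, l} \<in> null_sets lebesgue"
      using \<sigma>(1) by (simp add: negligible_iff_null_sets[symmetric] negligible_finite)
    show "{t \<in> space lebesgue. \<not> (t \<in> {0..l} \<longrightarrow>
        (\<exists>v. (\<sigma> has_vector_derivative v) (at t within {0..l}) \<and> kobayashi_royden \<Omega> (\<sigma> t) v \<le> L))} \<subseteq> F \<union> {0, l}"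
    proof (rule subsetI, rule ccontr)
      fix t assume t: "t \<in> {t \<in> space lebesgue. \<not> (t \<in> {0..l} \<longrightarrow>
        (\<exists>v. (\<sigma> has_vector_derivative v) (at t within {0..l}) \<and> kobayashi_royden \<Omega> (\<sigma> t) v \<le> L))}"
        and "t \<notin> F \<union> {0, l}"
      then have "t \<in> {0<..<l} - F" by auto
      then obtain v where "(\<sigma> has_vector_derivative v) (at t)" "kobayashi_royden \<Omega> (\<sigma> t) v \<le> 1"
        using \<sigma>(5) by blast
      then have "(\<sigma> has_vector_derivative v) (at t within {0..l})" "kobayashi_royden \<Omega> (\<sigma> t) v \<le> L"
        using L by (auto intro: has_vector_derivative_at_within)
      then show False using t by blast
    qed
  qed
  have "almost_geodesic \<Omega> L \<kappa> {0..l} \<sigma>"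
    unfolding almost_geodesic_def using \<sigma>(4) both ac ae is_interval_cc by blast
  then show ?thesis using l0 \<sigma>(2,3) by blast
qed

subsection \<open>Absolutely continuous curves\<close>

lemma abs_cont_on_subset: "abs_cont_on I \<sigma> \<Longrightarrow> J \<subseteq> I \<Longrightarrow> abs_cont_on J \<sigma>"
  unfolding abs_cont_on_def by (meson subsetD)

lemma abs_cont_on_imp_continuous_on:
  fixes \<sigma> :: "real \<Rightarrow> 'a::real_normed_vector"
  assumes "abs_cont_on I \<sigma>"
  shows "continuous_on I \<sigma>"
  unfolding continuous_on_iff
proof (intro ballI allI impI)
  fix x and \<epsilon> :: real assume x: "x \<in> I" and "\<epsilon> > 0"
  then obtain \<delta> where \<delta>: "\<delta> > 0" "\<And>(n::nat) a b.
        (\<forall>i<n. a i \<in> I \<and> b i \<in> I \<and> a i \<le> b i) \<and>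
        disjoint_family_on (\<lambda>i. {a i<..<b i}) {..<n} \<and>
        (\<Sum>i<n. b i - a i) < \<delta>
        \<longrightarrow> (\<Sum>i<n. norm (\<sigma> (b i) - \<sigma> (a i))) < \<epsilon>"
    using assms unfolding abs_cont_on_def by meson
  have "dist (\<sigma> y) (\<sigma> x) < \<epsilon>" if y: "y \<in> I" "dist y x < \<delta>" for y
    using \<delta>(2)[of 1 "\<lambda>_. min x y" "\<lambda>_. max x y"] x y
    by (auto simp: disjoint_family_on_def min_def max_def dist_norm norm_minus_commute split: if_splits)
  then show "\<exists>\<delta>>0. \<forall>y\<in>I. dist y x < \<delta> \<longrightarrow> dist (\<sigma> y) (\<sigma> x) < \<epsilon>"
    using \<delta>(1) by blast
qed

text \<open>Reindexing along a bijection with \<open>{..<card P}\<close> allows families over any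
  finite index set, here the tagged intervals of a division.\<close>

lemma abs_cont_on_finite_sum:
  fixes \<sigma> :: "real \<Rightarrow> 'a::real_normed_vector"
  assumes "abs_cont_on I \<sigma>" "\<epsilon> > 0"
  obtains \<delta> where "\<delta> > 0" "\<And>P a b. finite P \<Longrightarrow> (\<And>i. i \<in> P \<Longrightarrow> a i \<in> I \<and> b i \<in> I \<and> a i \<le> b i) \<Longrightarrow>
        disjoint_family_on (\<lambda>i. {a i<..<b i}) P \<Longrightarrow> (\<Sum>i\<in>P. b i - a i) < \<delta> \<Longrightarrow>
        (\<Sum>i\<in>P. norm (\<sigma> (b i) - \<sigma> (a i))) < \<epsilon>"
proof -
  from assms obtain \<delta> where \<delta>: "\<delta> > 0" "\<And>(n::nat) a b.
        (\<forall>i<n. a i \<in> I \<and> b i \<in> I \<and> a i \<le> b i) \<and>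
        disjoint_family_on (\<lambda>i. {a i<..<b i}) {..<n} \<and>
        (\<Sum>i<n. b i - a i) < \<delta>
        \<longrightarrow> (\<Sum>i<n. norm (\<sigma> (b i) - \<sigma> (a i))) < \<epsilon>"
    unfolding abs_cont_on_def by meson
  show ?thesis
  proof (rule that[OF \<delta>(1)])
    fix P :: "'b set" and a b
    assume P: "finite P" "\<And>i. i \<in> P \<Longrightarrow> a i \<in> I \<and> b i \<in> I \<and> a i \<le> b i"
      "disjoint_family_on (\<lambda>i. {a i<..<b i}) P" "(\<Sum>i\<in>P. b i - a i) < \<delta>"
    obtain \<pi> where \<pi>: "bij_betw \<pi> {..<card P} P"
      using ex_bij_betw_nat_finite[OF P(1)] by (auto simp: atLeast0LessThan)
    have mem: "\<pi> i \<in> P" if "i < card P" for i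
      using \<pi> that by (auto simp: bij_betw_def)
    have "disjoint_family_on (\<lambda>i. {(a \<circ> \<pi>) i<..<(b \<circ> \<pi>) i}) {..<card P}"
      unfolding disjoint_family_on_def
    proof (intro ballI impI)
      fix m n assume "m \<in> {..<card P}" "n \<in> {..<card P}" "m \<noteq> n"
      moreover from this have "\<pi> m \<noteq> \<pi> n"
        using \<pi> by (auto simp: bij_betw_def inj_on_def)
      ultimately show "{(a \<circ> \<pi>) m<..<(b \<circ> \<pi>) m} \<inter> {(a \<circ> \<pi>) n<..<(b \<circ> \<pi>) n} = {}"
        using P(3) mem unfolding disjoint_family_on_def by simp
    qed
    moreover have "(\<Sum>i<card P. (b \<circ> \<pi>) i - (a \<circ> \<pi>) i) < \<delta>"
      using P(4) sum.reindex_bij_betw[OF \<pi>, of "\<lambda>i. b i - a i"] by simp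
    ultimately have "(\<Sum>i<card P. norm (\<sigma> ((b \<circ> \<pi>) i) - \<sigma> ((a \<circ> \<pi>) i))) < \<epsilon>"
      using \<delta>(2)[of "card P" "a \<circ> \<pi>" "b \<circ> \<pi>"] P(2) mem by simp
    then show "(\<Sum>i\<in>P. norm (\<sigma> (b i) - \<sigma> (a i))) < \<epsilon>"
      using sum.reindex_bij_betw[OF \<pi>, of "\<lambda>i. norm (\<sigma> (b i) - \<sigma> (a i))"] by simp
  qed
qed

text \<open>Outer regularity makes \<open>T - N\<close> small, and adding the null set
  \<open>N\<close> does not change the measure.\<close>

lemma negligible_open_cover:
  fixes N :: "real set"
  assumes "negligible N" "\<delta> > 0"
  obtains T where "open T" "N \<subseteq> T" "T \<in> lmeasurable" "measure lebesgue T < \<delta>"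
proof -
  obtain T where T: "open T" "N \<subseteq> T" "T - N \<in> lmeasurable" "emeasure lebesgue (T - N) < ennreal \<delta>"
    using sets_lebesgue_outer_open[of N \<delta>] assms negligible_imp_sets by blast
  have N: "N \<in> null_sets lebesgue" using assms(1) by (simp add: negligible_iff_null_sets)
  have TN: "T = (T - N) \<union> N" using T by blast
  have TL: "T \<in> lmeasurable"
    using T N by (subst TN) (intro fmeasurable.Un, auto simp: fmeasurable_def)
  have "emeasure lebesgue T = emeasure lebesgue (T - N)"
    using T N by (subst TN) (intro emeasure_Un_null_set, auto simp: fmeasurable_def)
  then have "ennreal (measure lebesgue T) < ennreal \<delta>"
    using T(4) emeasure_eq_measure2[OF TL] by simp
  then have "measure lebesgue T < \<delta>"
    by (simp add: ennreal_less_iff)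
  then show ?thesis using that T(1,2) TL by blast
qed

text \<open>The Cousin partition is tagged so that intervals with tags outside the exceptional null set
  see the derivative, while the remaining ones have small total length and are handled by absolute
  continuity.\<close>

lemma abs_cont_on_norm_le_integral:
  fixes \<sigma> :: "real \<Rightarrow> 'a::real_normed_vector"
  assumes ab: "a \<le> b" and ac: "abs_cont_on {a..b} \<sigma>" and N: "negligible N"
    and deriv: "\<And>t. t \<in> {a..b} - N \<Longrightarrow> \<exists>v. (\<sigma> has_vector_derivative v) (at t within {a..b}) \<and> norm v \<le> h t"
    and h0: "\<And>t. h t \<ge> 0" and hJ: "(h has_integral J) {a..b}"
  shows "norm (\<sigma> b - \<sigma> a) \<le> J"
proof (rule field_le_epsilon)
  fix e :: real assume "e > 0"
  \<comment> \<open>One third each for the Riemann sum of \<open>h\<close>, for the linearisation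
    error \<open>e2 * (b - a)\<close>, and for the intervals tagged in \<open>N\<close>.\<close>
  define e1 where "e1 = e / 3"
  define e2 where "e2 = e1 / (b - a + 1)"
  have e1: "e1 > 0" using \<open>e > 0\<close> by (simp add: e1_def)
  have e2: "e2 > 0" using e1 ab by (simp add: e2_def)
  have e2ab: "e2 * (b - a) \<le> e1"
  proof -
    have "e2 * (b - a) \<le> e2 * (b - a + 1)" using e2 by simp
    also have "\<dots> = e1" using ab by (simp add: e2_def)
    finally show ?thesis .
  qed
  obtain \<delta> where \<delta>: "\<delta> > 0" "\<And>(P :: (real \<times> real set) set) u v. finite P \<Longrightarrow>
        (\<And>i. i \<in> P \<Longrightarrow> u i \<in> {a..b} \<and> v i \<in> {a..b} \<and> u i \<le> v i) \<Longrightarrow>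
        disjoint_family_on (\<lambda>i. {u i<..<v i}) P \<Longrightarrow> (\<Sum>i\<in>P. v i - u i) < \<delta> \<Longrightarrow>
        (\<Sum>i\<in>P. norm (\<sigma> (v i) - \<sigma> (u i))) < e1"
    using abs_cont_on_finite_sum[OF ac e1] by blast
  obtain T where T: "open T" "N \<subseteq> T" "T \<in> lmeasurable" "measure lebesgue T < \<delta>"
    using negligible_open_cover[OF N \<delta>(1)] by blast
  obtain g1 where g1: "gauge g1" "\<And>p. p tagged_division_of {a..b} \<Longrightarrow> g1 fine p \<Longrightarrow>
        norm ((\<Sum>(x,k)\<in>p. measure lborel k *\<^sub>R h x) - J) < e1"
    using hJ e1 unfolding has_integral_real by meson
  have "\<exists>r. r > 0 \<and> (x \<in> {a..b} - N \<longrightarrow> (\<exists>v. norm v \<le> h x \<and>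
      (\<forall>y\<in>{a..b}. norm (y - x) < r \<longrightarrow> norm (\<sigma> y - \<sigma> x - (y - x) *\<^sub>R v) \<le> e2 * norm (y - x))))" for x
  proof (cases "x \<in> {a..b} - N")
    case True
    then obtain v where "(\<sigma> has_vector_derivative v) (at x within {a..b})" "norm v \<le> h x"
      using deriv by blast
    then show ?thesis
      using e2 unfolding has_vector_derivative_def has_derivative_within_alt by blast
  qed (auto intro: exI[of _ 1])
  then obtain r where r: "\<And>x. r x > 0" "\<And>x. x \<in> {a..b} - N \<Longrightarrow> \<exists>v. norm v \<le> h x \<and>
      (\<forall>y\<in>{a..b}. norm (y - x) < r x \<longrightarrow> norm (\<sigma> y - \<sigma> x - (y - x) *\<^sub>R v) \<le> e2 * norm (y - x))"
    by metis
  \<comment> \<open>Intervals tagged in \<open>N\<close> are forced into \<open>T\<close>, all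
    others into the range where the derivative at the tag controls the increment.\<close>
  define g2 where "g2 = (\<lambda>x. if x \<in> N then T else ball x (r x))"
  have g2: "gauge g2"
    using T r by (auto simp: gauge_def g2_def)
  obtain p where p: "p tagged_division_of {a..b}" "(\<lambda>x. g1 x \<inter> g2 x) fine p"
    using fine_division_exists_real[OF gauge_Int[OF g1(1) g2]] by blast
  have p1: "g1 fine p" and p2: "g2 fine p" using p(2) by (auto simp: fine_Int)
  note pD = tagged_division_ofD[OF p(1)]
  have K: "K = {Inf K..Sup K} \<and> a \<le> Inf K \<and> Inf K \<le> x \<and> x \<le> Sup K \<and> Sup K \<le> b \<and> measure lborel K = Sup K - Inf K"
    if xK: "(x, K) \<in> p" for x K
  proof -
    obtain u v where uv: "K = {u..v}" using pD(4)[OF xK] by auto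
    have x: "u \<le> x" "x \<le> v" using pD(2)[OF xK] uv by auto
    then have "Inf K = u" "Sup K = v" using uv by auto
    moreover have "a \<le> u" "v \<le> b" using pD(3)[OF xK] x uv by auto
    ultimately show ?thesis using x uv by auto
  qed
  define D where "D = (\<lambda>(x::real, K). norm (\<sigma> (Sup K) - \<sigma> (Inf K)))"
  define q where "q = {i \<in> p. fst i \<in> N}"
  have fin: "finite p" "finite q" using pD(1) by (auto simp: q_def)
  have "\<sigma> b - \<sigma> a = (\<Sum>(x,K)\<in>p. \<sigma> (Sup K) - \<sigma> (Inf K))"
    by (rule additive_tagged_division_1[OF ab p(1), symmetric])
  then have "norm (\<sigma> b - \<sigma> a) \<le> (\<Sum>i\<in>p. D i)"
    by (auto simp: D_def split_def intro: order_trans[OF norm_sum])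
  also have "\<dots> = (\<Sum>i\<in>p - q. D i) + (\<Sum>i\<in>q. D i)"
    using fin by (intro sum.subset_diff) (auto simp: q_def)
  also have "\<dots> \<le> (J + 2 * e1) + e1"
  proof (rule add_mono)
    have "(\<Sum>i\<in>p - q. D i) \<le> (\<Sum>(x,K)\<in>p - q. measure lborel K *\<^sub>R h x + e2 * measure lborel K)"
    proof (rule sum_mono, clarify)
      fix x K assume xK: "(x, K) \<in> p" "(x, K) \<notin> q"
      then have xN: "x \<notin> N" by (auto simp: q_def)
      note k = K[OF xK(1)]
      define u v where "u = Inf K" and "v = Sup K"
      have uv: "K = {u..v}" "a \<le> u" "u \<le> x" "x \<le> v" "v \<le> b" "measure lborel K = v - u"
        using k by (auto simp: u_def v_def)
      obtain w where w: "norm w \<le> h x"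
        "\<And>y. y \<in> {a..b} \<Longrightarrow> norm (y - x) < r x \<Longrightarrow> norm (\<sigma> y - \<sigma> x - (y - x) *\<^sub>R w) \<le> e2 * norm (y - x)"
        using r(2)[of x] xN uv by auto
      have "K \<subseteq> ball x (r x)" using fineD[OF p2 xK(1)] xN by (simp add: g2_def)
      moreover have "u \<in> K" "v \<in> K" using uv by auto
      ultimately have "u \<in> ball x (r x)" "v \<in> ball x (r x)" by blast+
      then have wu: "norm (\<sigma> u - \<sigma> x - (u - x) *\<^sub>R w) \<le> e2 * norm (u - x)"
        and wv: "norm (\<sigma> v - \<sigma> x - (v - x) *\<^sub>R w) \<le> e2 * norm (v - x)"
        using w(2)[of u] w(2)[of v] uv by (auto simp: dist_real_def abs_minus_commute)
      have "\<sigma> v - \<sigma> u = (v - u) *\<^sub>R w + (\<sigma> v - \<sigma> x - (v - x) *\<^sub>R w) - (\<sigma> u - \<sigma> x - (u - x) *\<^sub>R w)"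
        by (simp add: algebra_simps)
      then have "norm (\<sigma> v - \<sigma> u) \<le> norm ((v - u) *\<^sub>R w) + norm (\<sigma> v - \<sigma> x - (v - x) *\<^sub>R w)
          + norm (\<sigma> u - \<sigma> x - (u - x) *\<^sub>R w)"
        by (metis add.assoc norm_triangle_ineq norm_triangle_ineq4 order_trans add_right_mono)
      also have "\<dots> \<le> (v - u) * norm w + e2 * (v - x) + e2 * (x - u)"
        using wu wv uv by simp
      also have "\<dots> = (v - u) * norm w + e2 * (v - u)"
        by (simp add: algebra_simps)
      also have "\<dots> \<le> (v - u) * h x + e2 * (v - u)"
        using w(1) uv by (intro add_right_mono mult_left_mono) auto
      finally show "D (x, K) \<le> measure lborel K *\<^sub>R h x + e2 * measure lborel K"
        by (simp add: D_def u_def[symmetric] v_def[symmetric] uv(6))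
    qed
    \<comment> \<open>Adding the terms tagged in \<open>N\<close> only increases the sum, as
      \<open>h\<close> is nonnegative, and completes the Riemann sum over the whole
      division.\<close>
    also have "\<dots> \<le> (\<Sum>(x,K)\<in>p. measure lborel K *\<^sub>R h x + e2 * measure lborel K)"
      using fin e2 h0 by (intro sum_mono2) auto
    also have "\<dots> = (\<Sum>(x,K)\<in>p. measure lborel K *\<^sub>R h x) + e2 * (\<Sum>(x,K)\<in>p. measure lborel K)"
      by (simp add: split_def sum.distrib sum_distrib_left)
    also have "(\<Sum>(x,K)\<in>p. measure lborel K) = b - a"
      using additive_content_tagged_division[of p a b] p(1) ab by simp
    also have "(\<Sum>(x,K)\<in>p. measure lborel K *\<^sub>R h x) + e2 * (b - a) \<le> (J + e1) + e1"
      using g1(2)[OF p(1) p1] e2ab by (intro add_mono) auto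
    finally show "(\<Sum>i\<in>p - q. D i) \<le> J + 2 * e1" by simp
  next
    define A where "A = (\<lambda>i::real \<times> real set. {Inf (snd i)<..<Sup (snd i)})"
    have le: "Inf (snd i) \<le> Sup (snd i)" if "i \<in> q" for i
      using that K[of "fst i" "snd i"] by (force simp: q_def)
    have disj: "disjoint_family_on A q"
      unfolding disjoint_family_on_def
    proof (intro ballI impI)
      fix i j assume ij: "i \<in> q" "j \<in> q" "i \<noteq> j"
      obtain x K y L where [simp]: "i = (x, K)" "j = (y, L)" by fastforce
      have xy: "(x, K) \<in> p" "(y, L) \<in> p" using ij by (auto simp: q_def)
      have "interior K = A i" "interior L = A j"
        using K[OF xy(1)] K[OF xy(2)] by (metis A_def \<open>i = (x, K)\<close> interior_atLeastAtMost_real snd_conv,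
            metis A_def \<open>j = (y, L)\<close> interior_atLeastAtMost_real snd_conv)
      then show "A i \<inter> A j = {}" using pD(5)[OF xy] ij by auto
    qed
    \<comment> \<open>The interiors are disjoint and lie in \<open>T\<close>, so their total length
      is at most the measure of \<open>T\<close>.\<close>
    have "(\<Sum>i\<in>q. Sup (snd i) - Inf (snd i)) = (\<Sum>i\<in>q. measure lebesgue (A i))"
      using le by (intro sum.cong) (simp_all add: A_def)
    also have "\<dots> = measure lebesgue (\<Union>i\<in>q. A i)"
      using fin disj le by (intro measure_finite_Union[symmetric]) (auto simp: A_def)
    also have "\<dots> \<le> measure lebesgue T"
    proof (rule measure_mono_fmeasurable[OF _ _ T(3)])
      show "(\<Union>i\<in>q. A i) \<subseteq> T"
      proof (clarsimp simp: q_def)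
        fix x K y assume xK: "(x, K) \<in> p" "x \<in> N" and y: "y \<in> A (x, K)"
        then have "y \<in> K" using K[OF xK(1)] by (metis A_def atLeastAtMost_iff greaterThanLessThan_iff less_imp_le snd_conv)
        moreover have "K \<subseteq> T" using fineD[OF p2 xK(1)] xK(2) by (simp add: g2_def)
        ultimately show "y \<in> T" by blast
      qed
      show "(\<Union>i\<in>q. A i) \<in> sets lebesgue"
        using fin by (intro sets.finite_UN) (simp_all add: A_def)
    qed
    finally have "(\<Sum>i\<in>q. Sup (snd i) - Inf (snd i)) < \<delta>" using T(4) by linarith
    then have "(\<Sum>i\<in>q. norm (\<sigma> (Sup (snd i)) - \<sigma> (Inf (snd i)))) < e1"
      using K fin disj by (intro \<delta>(2)) (force simp: q_def A_def)+
    then show "(\<Sum>i\<in>q. D i) \<le> e1" by (simp add: D_def split_def)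
  qed
  also have "(J + 2 * e1) + e1 = J + e" by (simp add: e1_def)
  finally show "norm (\<sigma> b - \<sigma> a) \<le> J + e" .
qed

subsection \<open>The speed of almost-geodesics\<close>

lemma frontier_nonempty_bounded:
  fixes \<Omega> :: "(complex ^ 'd) set"
  assumes "bounded \<Omega>" "\<Omega> \<noteq> {}"
  shows "frontier \<Omega> \<noteq> {}"
  using assms frontier_eq_empty not_bounded_UNIV by metis

lemma bdist_pos:
  fixes \<Omega> :: "(complex ^ 'd) set"
  assumes "open \<Omega>" "bounded \<Omega>" "z \<in> \<Omega>"
  shows "bdist \<Omega> z > 0"
  unfolding bdist_def
proof (rule infdist_pos_not_in_closed)
  show "frontier \<Omega> \<noteq> {}" using frontier_nonempty_bounded assms by blast
  show "z \<notin> frontier \<Omega>" using assms by (simp add: frontier_def interior_open)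
qed simp

text \<open>Ensures that the set defining \<open>M_fun\<close> is nonempty for every positive
  radius.\<close>

lemma points_near_frontier:
  fixes \<Omega> :: "(complex ^ 'd) set"
  assumes "open U" "q \<in> U" "q \<in> frontier \<Omega>" "r > 0"
  shows "\<exists>z \<in> U \<inter> \<Omega>. bdist \<Omega> z \<le> r"
proof -
  obtain e where e: "e > 0" "ball q e \<subseteq> U" using assms openE by blast
  have "q \<in> closure \<Omega>" using assms by (simp add: frontier_def)
  then obtain z where z: "z \<in> \<Omega>" "dist z q < min e r"
    using e assms(4) by (meson closure_approachable min_less_iff_conj)
  then have "z \<in> U" using e by (auto simp: dist_commute)
  moreover have "bdist \<Omega> z \<le> dist z q" unfolding bdist_def by (rule infdist_le) fact
  ultimately show ?thesis using z by (intro bexI[of _ z]) auto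
qed

section \<open>Comparison of the speed with \<open>M_fun\<close>\<close>

context
  fixes \<Omega> U :: "(complex ^ 'd) set"
  assumes \<Omega>: "open \<Omega>" "bounded \<Omega>"
begin

lemma kobayashi_royden_pos:
  assumes "z \<in> \<Omega>" "v \<noteq> 0"
  shows "kobayashi_royden \<Omega> z v > 0"
proof -
  obtain C where C: "C > 0" "\<And>z v. z \<in> \<Omega> \<Longrightarrow> norm v \<le> C * kobayashi_royden \<Omega> z v"
    using kobayashi_royden_lower[OF \<Omega>] by blast
  have "0 < norm v" using assms by simp
  also have "\<dots> \<le> C * kobayashi_royden \<Omega> z v" using C(2) assms by blast
  finally show ?thesis using C(1) by (simp add: zero_less_mult_iff)
qed

lemma M_fun_bdd_above:
  "bdd_above {1 / kobayashi_royden \<Omega> z v | z v. z \<in> U \<inter> \<Omega> \<and> bdist \<Omega> z \<le> r \<and> norm v = 1}"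
proof -
  obtain C where C: "C > 0" "\<And>z v. z \<in> \<Omega> \<Longrightarrow> norm v \<le> C * kobayashi_royden \<Omega> z v"
    using kobayashi_royden_lower[OF \<Omega>] by blast
  show ?thesis
  proof (rule bdd_aboveI[of _ C], clarify)
    fix z and v :: "complex ^ 'd" assume zv: "z \<in> \<Omega>" "norm v = 1"
    then have "v \<noteq> 0" by auto
    then have "kobayashi_royden \<Omega> z v > 0" using kobayashi_royden_pos[of z v] zv by blast
    then show "1 / kobayashi_royden \<Omega> z v \<le> C"
      using C(2)[of z v] zv by (simp add: pos_divide_le_eq)
  qed
qed

lemma M_fun_upper:
  assumes "z \<in> U \<inter> \<Omega>" "bdist \<Omega> z \<le> r" "norm v = 1"
  shows "1 / kobayashi_royden \<Omega> z v \<le> M_fun \<Omega> U r"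
  unfolding M_fun_def using assms by (intro cSup_upper M_fun_bdd_above) blast

lemma M_fun_nonneg:
  assumes "z \<in> U \<inter> \<Omega>" "bdist \<Omega> z \<le> r"
  shows "0 \<le> M_fun \<Omega> U r"
proof -
  obtain v :: "complex ^ 'd" where v: "norm v = 1" using vector_choose_size[of 1] by auto
  then have "v \<noteq> 0" by auto
  then have "0 \<le> 1 / kobayashi_royden \<Omega> z v" using kobayashi_royden_pos[of z v] assms by simp
  then show ?thesis using M_fun_upper[OF assms v] by linarith
qed

text \<open>A larger radius admits more points. The point \<open>z\<close> witnesses that the
  smaller set is nonempty, as comparing real suprema requires.\<close>

lemma M_fun_mono:
  assumes "z \<in> U \<inter> \<Omega>" "bdist \<Omega> z \<le> r" "r \<le> s"
  shows "M_fun \<Omega> U r \<le> M_fun \<Omega> U s"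
  unfolding M_fun_def
proof (rule cSup_subset_mono[OF _ M_fun_bdd_above])
  obtain v :: "complex ^ 'd" where v: "norm v = 1" using vector_choose_size[of 1] by auto
  then show "{1 / kobayashi_royden \<Omega> z v |z v. z \<in> U \<inter> \<Omega> \<and> bdist \<Omega> z \<le> r \<and> norm v = 1} \<noteq> {}"
    using assms by blast
  show "{1 / kobayashi_royden \<Omega> z v |z v. z \<in> U \<inter> \<Omega> \<and> bdist \<Omega> z \<le> r \<and> norm v = 1}
      \<subseteq> {1 / kobayashi_royden \<Omega> z v |z v. z \<in> U \<inter> \<Omega> \<and> bdist \<Omega> z \<le> s \<and> norm v = 1}"
    using assms(3) order_trans by fast
qed

text \<open>By homogeneity the metric of \<open>v\<close> is \<open>norm v\<close> times that of the
  unit vector \<open>w\<close>, whose reciprocal is bounded by \<open>M_fun\<close>.\<close>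

lemma speed_le_M_fun:
  assumes z: "z \<in> U \<inter> \<Omega>" and le: "kobayashi_royden \<Omega> z v \<le> L" and "L \<ge> 0"
  shows "norm v \<le> L * M_fun \<Omega> U (bdist \<Omega> z)"
proof (cases "v = 0")
  case True
  then show ?thesis using M_fun_nonneg[OF z order_refl] assms(3) by simp
next
  case False
  define w where "w = (1 / norm v) *\<^sub>R v"
  have w: "norm w = 1" "v = norm v *\<^sub>R w" "w \<noteq> 0" using False by (simp_all add: w_def)
  have p: "kobayashi_royden \<Omega> z w > 0" using kobayashi_royden_pos[OF _ w(3)] z by blast
  have "kobayashi_royden \<Omega> z v = norm v * kobayashi_royden \<Omega> z w"
    using kobayashi_royden_scale[OF \<Omega>(1), of z "norm v" w] z False w(2) by simp
  then have "norm v \<le> L * (1 / kobayashi_royden \<Omega> z w)"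
    using p le by (simp add: pos_le_divide_eq)
  also have "\<dots> \<le> L * M_fun \<Omega> U (bdist \<Omega> z)"
    using M_fun_upper[OF z order_refl w(1)] assms(3) by (intro mult_left_mono)
  finally show ?thesis .
qed

text \<open>Almost everywhere the Euclidean speed is at most \<open>L * M_fun\<close>. A Borel
  majorant \<open>h\<close> is integrated in its place, so that only \<open>h\<close> has to be
  measurable.\<close>

lemma almost_geodesic_displacement:
  assumes ag: "almost_geodesic \<Omega> L \<kappa> {a..b} \<sigma>" and ab: "a \<le> b" and L: "L \<ge> 0" and U: "\<sigma> ` {a..b} \<subseteq> U"
    and h: "h \<in> borel_measurable borel" "\<And>t. h t \<ge> (0::real)"
    and hM: "\<And>t. t \<in> {a..b} \<Longrightarrow> L * M_fun \<Omega> U (bdist \<Omega> (\<sigma> t)) \<le> h t"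
    and fin: "(\<integral>\<^sup>+t. ennreal (h t) * indicator {a..b} t \<partial>lborel) < ennreal K"
  shows "norm (\<sigma> b - \<sigma> a) < K"
proof -
  have "AE t in lebesgue. t \<in> {a..b} \<longrightarrow>
        (\<exists>v. (\<sigma> has_vector_derivative v) (at t within {a..b}) \<and> kobayashi_royden \<Omega> (\<sigma> t) v \<le> L)"
    using ag by (simp add: almost_geodesic_def)
  then obtain N where N: "\<And>t. t \<in> space lebesgue - N \<Longrightarrow> t \<in> {a..b} \<longrightarrow>
        (\<exists>v. (\<sigma> has_vector_derivative v) (at t within {a..b}) \<and> kobayashi_royden \<Omega> (\<sigma> t) v \<le> L)"
    "N \<in> null_sets lebesgue"
    by (rule AE_E3) blast
  define I where "I = (\<integral>\<^sup>+t. ennreal (h t) * indicator {a..b} t \<partial>lborel)"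
  have "I < \<infinity>" using fin unfolding I_def by (rule less_trans) simp
  then obtain J where J: "I = ennreal J" "J \<ge> 0" by (cases I) auto
  \<comment> \<open>The finite nonnegative integral is turned into a gauge integral, the form used
    by \<open>abs_cont_on_norm_le_integral\<close>.\<close>
  have hi: "((\<lambda>t. h t * indicator {a..b} t) has_integral J) UNIV"
  proof (rule nn_integral_has_integral)
    have "I = (\<integral>\<^sup>+t. ennreal (h t * indicator {a..b} t) \<partial>lborel)"
      unfolding I_def by (rule nn_integral_cong) (auto simp: indicator_def)
    then show "(\<integral>\<^sup>+t. ennreal (h t * indicator {a..b} t) \<partial>lborel) = ennreal J"
      using J by simp
  qed (use h J in auto)
  have "(h has_integral J) {a..b}"
    using hi unfolding has_integral_restrict_UNIV[of "{a..b}" h, symmetric]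
    by (rule has_integral_eq[rotated]) (auto simp: indicator_def)
  then have "norm (\<sigma> b - \<sigma> a) \<le> J"
  proof (rule abs_cont_on_norm_le_integral[OF ab, rotated -1])
    show "abs_cont_on {a..b} \<sigma>" using ag by (simp add: almost_geodesic_def)
    show "negligible N" using N(2) by (simp add: negligible_iff_null_sets)
    fix t assume t: "t \<in> {a..b} - N"
    then obtain v where v: "(\<sigma> has_vector_derivative v) (at t within {a..b})" "kobayashi_royden \<Omega> (\<sigma> t) v \<le> L"
      using N(1)[of t] by auto
    have "\<sigma> t \<in> U \<inter> \<Omega>" using t U ag by (auto simp: almost_geodesic_def)
    from speed_le_M_fun[OF this v(2) L] have "norm v \<le> h t" using hM[of t] t by auto
    then show "\<exists>v. (\<sigma> has_vector_derivative v) (at t within {a..b}) \<and> norm v \<le> h t" using v by blast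
  qed (use h in auto)
  also have "J < K"
    using fin J unfolding I_def[symmetric] by (simp add: ennreal_less_iff)
  finally show ?thesis .
qed

end

lemma almost_geodesic_subinterval:
  assumes "almost_geodesic \<Omega> L \<kappa> {a..b} \<sigma>" "a \<le> c" "d \<le> b"
  shows "almost_geodesic \<Omega> L \<kappa> {c..d} \<sigma>"
proof -
  have sub: "{c..d} \<subseteq> {a..b}" using assms by auto
  have "AE t in lebesgue. t \<in> {a..b} \<longrightarrow>
        (\<exists>v. (\<sigma> has_vector_derivative v) (at t within {a..b}) \<and> kobayashi_royden \<Omega> (\<sigma> t) v \<le> L)"
    using assms by (simp add: almost_geodesic_def)
  then have "AE t in lebesgue. t \<in> {c..d} \<longrightarrow>
        (\<exists>v. (\<sigma> has_vector_derivative v) (at t within {c..d}) \<and> kobayashi_royden \<Omega> (\<sigma> t) v \<le> L)"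
    by (rule eventually_mono) (use sub in \<open>blast intro: has_vector_derivative_within_subset\<close>)
  then show ?thesis
    using assms(1) sub abs_cont_on_subset[of "{a..b}" \<sigma> "{c..d}"]
    unfolding almost_geodesic_def by (auto simp: is_interval_cc)
qed

subsection \<open>Visibility near a good boundary point\<close>

text \<open>A left inverse of \<open>f\<close> on \<open>{0<..}\<close>, defined and monotone on all of \<open>\<real>\<close>.\<close>

definition inv_above :: "(real \<Rightarrow> real) \<Rightarrow> real \<Rightarrow> real" where
  "inv_above f y = Inf {x. 0 < x \<and> y \<le> f x}"

lemma inv_above_le: "0 < x \<Longrightarrow> y \<le> f x \<Longrightarrow> inv_above f y \<le> x"
  unfolding inv_above_def by (rule cInf_lower) (auto intro!: bdd_belowI[of _ 0])

text \<open>As \<open>f\<close> tends to infinity, all the sets are nonempty, and they shrink as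
  \<open>y\<close> grows. Monotonicity later supplies Borel measurability.\<close>

lemma inv_above_mono:
  assumes "filterlim f at_top at_top"
  shows "mono (inv_above f)"
proof (rule monoI)
  fix y y' :: real assume "y \<le> y'"
  have "eventually (\<lambda>x. 0 < x \<and> y' \<le> f x) at_top"
    using assms eventually_gt_at_top[of 0] unfolding filterlim_at_top by (auto intro: eventually_conj)
  then have "{x. 0 < x \<and> y' \<le> f x} \<noteq> {}"
    using eventually_happens[of _ "at_top :: real filter"] by auto
  then show "inv_above f y \<le> inv_above f y'"
    unfolding inv_above_def using \<open>y \<le> y'\<close>
    by (intro cInf_superset_mono) (auto intro!: bdd_belowI[of _ 0])
qed

lemma inv_above_eq:
  assumes "strict_mono_on {0<..} f" "0 < x"
  shows "inv_above f (f x) = x"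
proof (rule antisym)
  show "inv_above f (f x) \<le> x" using assms by (intro inv_above_le) auto
  show "x \<le> inv_above f (f x)"
    unfolding inv_above_def
  proof (rule cInf_greatest)
    fix x' assume "x' \<in> {x'. 0 < x' \<and> f x \<le> f x'}"
    then show "x \<le> x'" using strict_mono_onD[OF assms(1), of x' x] assms(2) by force
  qed (use assms in auto)
qed

text \<open>Dominated convergence: every fixed \<open>r\<close> eventually leaves the shrinking
  intervals.\<close>

lemma nn_integral_tail_tendsto_0:
  fixes \<Phi> :: "real \<Rightarrow> real"
  assumes "\<Phi> \<in> borel_measurable borel" "0 < r0"
    and fin: "(\<integral>\<^sup>+ r\<in>{0<..<r0}. ennreal (\<Phi> r) \<partial>lborel) < \<infinity>"
  shows "(\<lambda>n. \<integral>\<^sup>+ r\<in>{0<..<r0 / Suc n}. ennreal (\<Phi> r) \<partial>lborel) \<longlonglongrightarrow> 0"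
proof -
  have "(\<lambda>n. \<integral>\<^sup>+ r\<in>{0<..<r0 / Suc n}. ennreal (\<Phi> r) \<partial>lborel) \<longlonglongrightarrow> (\<integral>\<^sup>+ r. 0 \<partial>(lborel::real measure))"
  proof (rule nn_integral_dominated_convergence[OF _ _ _ _ fin])
    fix n
    have "r0 / Suc n \<le> r0" using assms(2) by (simp add: divide_simps)
    then show "AE r in lborel. ennreal (\<Phi> r) * indicator {0<..<r0 / Suc n} r \<le> ennreal (\<Phi> r) * indicator {0<..<r0} r"
      by (auto simp: indicator_def)
  next
    show "AE r in lborel. (\<lambda>n. ennreal (\<Phi> r) * indicator {0<..<r0 / Suc n} r) \<longlonglongrightarrow> 0"
    proof (rule AE_I2)
      fix r :: real
      have "eventually (\<lambda>n. r \<notin> {0<..<r0 / Suc n}) sequentially"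
      proof (cases "r > 0")
        case True
        have "(\<lambda>n. r0 / real (Suc n)) \<longlonglongrightarrow> 0"
          using LIMSEQ_Suc[OF lim_const_over_n[of r0]] by simp
        then have "eventually (\<lambda>n. r0 / real (Suc n) < r) sequentially"
          using True by (rule order_tendstoD)
        then show ?thesis by (rule eventually_mono) auto
      qed auto
      then have "eventually (\<lambda>n. ennreal (\<Phi> r) * indicator {0<..<r0 / Suc n} r = 0) sequentially"
        by (rule eventually_mono) simp
      then show "(\<lambda>n. ennreal (\<Phi> r) * indicator {0<..<r0 / Suc n} r) \<longlonglongrightarrow> 0"
        by (rule tendsto_eventually)
    qed
  qed (use assms in auto)
  then show ?thesis by simp
qed

text \<open>The interval is cut at \<open>c\<close>; the right half is translated and the left half
  reflected into \<open>{0..S}\<close>, which accounts for the factor 2.\<close>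

lemma nn_integral_radial_le:
  fixes g :: "real \<Rightarrow> real"
  assumes [measurable]: "g \<in> borel_measurable borel" and c: "c \<in> {a..b}" and S: "b - a \<le> S"
  shows "(\<integral>\<^sup>+t. ennreal (g \<bar>t - c\<bar>) * indicator {a..b} t \<partial>lborel)
    \<le> 2 * (\<integral>\<^sup>+s. ennreal (g s) * indicator {0..S} s \<partial>lborel)"
proof -
  define G where "G = (\<lambda>s. ennreal (g s) * indicator {0..S} s)"
  have G[measurable]: "G \<in> borel_measurable borel" by (simp add: G_def)
  have 1: "(\<integral>\<^sup>+t. G (t - c) \<partial>lborel) = (\<integral>\<^sup>+s. G s \<partial>lborel)"
    using nn_integral_real_affine[OF G, of 1 "-c"] by (simp add: add.commute[of "-c"])
  have 2: "(\<integral>\<^sup>+t. G (c - t) \<partial>lborel) = (\<integral>\<^sup>+s. G s \<partial>lborel)"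
    using nn_integral_real_affine[OF G, of "-1" c] by simp
  have "(\<integral>\<^sup>+t. ennreal (g \<bar>t - c\<bar>) * indicator {a..b} t \<partial>lborel) \<le> (\<integral>\<^sup>+t. G (t - c) + G (c - t) \<partial>lborel)"
  proof (rule nn_integral_mono)
    fix t :: real
    show "ennreal (g \<bar>t - c\<bar>) * indicator {a..b} t \<le> G (t - c) + G (c - t)"
    proof (cases "t \<in> {a..b}")
      case True
      show ?thesis
      proof (cases "c \<le> t")
        case le: True
        then have "ennreal (g \<bar>t - c\<bar>) * indicator {a..b} t = G (t - c)"
          using True c S by (simp add: G_def)
        then show ?thesis by simp
      next
        case False
        then have "ennreal (g \<bar>t - c\<bar>) * indicator {a..b} t = G (c - t)"
          using True c S by (simp add: G_def)
        then show ?thesis by simp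
      qed
    qed simp
  qed
  also have "\<dots> = 2 * (\<integral>\<^sup>+s. G s \<partial>lborel)"
    by (subst nn_integral_add) (auto simp: 1 2 mult_2)
  finally show ?thesis by (simp add: G_def)
qed

text \<open>The substitution is \<open>s = L * (2 * f (1 / r) + \<kappa>)\<close>. Since
  \<open>inv_above f\<close> undoes \<open>f\<close>, the integrand becomes \<open>M0 r\<close>,
  while the change of variable contributes
  \<open>2 * L * deriv f (1 / r) / r\<^sup>2\<close>.\<close>

lemma inverse_time_substitution:
  fixes f M0 :: "real \<Rightarrow> real"
  assumes df: "f differentiable_on {0<..}" and cf: "continuous_on {0<..} (deriv f)"
    and mf: "strict_mono_on {0<..} f" and ff: "filterlim f at_top at_top"
    and M0: "mono M0" "\<And>r. 0 \<le> M0 r"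
    and L: "L > 0" and e: "0 < e" "e \<le> r1"
  shows "(\<integral>\<^sup>+s. ennreal (M0 (1 / inv_above f ((s / L - \<kappa>) / 2))) *
        indicator {L * (2 * f (1 / r1) + \<kappa>)..L * (2 * f (1 / e) + \<kappa>)} s \<partial>lborel)
      = ennreal (2 * L) * (\<integral>\<^sup>+r. ennreal (M0 r / r\<^sup>2 * deriv f (1 / r)) * indicator {e..r1} r \<partial>lborel)"
proof -
  define F where "F = (\<lambda>s. M0 (1 / inv_above f ((s / L - \<kappa>) / 2)))"
  \<comment> \<open>Time decreases as \<open>r\<close> grows; the minus sign gives the nonnegative
    derivative that the substitution rule asks for, and a reflection undoes it at the end.\<close>
  define G where "G = (\<lambda>r. - (L * (2 * f (1 / r) + \<kappa>)))"
  have [measurable]: "M0 \<in> borel_measurable borel" "inv_above f \<in> borel_measurable borel"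
    using M0 inv_above_mono[OF ff] by (auto intro: borel_measurable_mono)
  have F[measurable]: "F \<in> borel_measurable borel" unfolding F_def by measurable
  have Df: "(f has_real_derivative deriv f x) (at x)" if "x > 0" for x
  proof -
    have "f differentiable (at x within {0<..})"
      using df that by (simp add: differentiable_on_def)
    then have "f differentiable at x"
      using that by (simp add: at_within_open[of x "{0<..}"])
    then show ?thesis by (simp add: DERIV_deriv_iff_real_differentiable)
  qed
  have pos: "deriv f x \<ge> 0" if x: "x > 0" for x
  proof (rule ccontr)
    assume "\<not> deriv f x \<ge> 0"
    then obtain d where d: "d > 0" "\<And>h. 0 < h \<Longrightarrow> h < d \<Longrightarrow> f (x + h) < f x"
      using DERIV_neg_dec_right[OF Df[OF x]] by auto
    then have "f (x + d/2) < f x" by simp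
    moreover have "f x < f (x + d/2)" using d x by (intro strict_mono_onD[OF mf]) auto
    ultimately show False by simp
  qed
  have "(\<integral>\<^sup>+x. ennreal (F (- x)) * indicator {G e..G r1} x \<partial>lborel)
     = (\<integral>\<^sup>+r. ennreal (F (- G r)) * ennreal (2 * L * deriv f (1 / r) / r\<^sup>2) * indicator {e..r1} r \<partial>lborel)"
  proof -
    have "(\<integral>\<^sup>+x. ennreal (F (- x) * indicator {G e..G r1} x) \<partial>lborel)
     = (\<integral>\<^sup>+r. ennreal (F (- G r) * (2 * L * deriv f (1 / r) / r\<^sup>2) * indicator {e..r1} r) \<partial>lborel)"
    proof (rule nn_integral_substitution)
      show "set_borel_measurable borel {G e..G r1} (\<lambda>x. F (- x))"
        unfolding set_borel_measurable_def by measurable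
      show "(G has_real_derivative 2 * L * deriv f (1 / r) / r\<^sup>2) (at r)" if "r \<in> {e..r1}" for r
      proof -
        have r: "r > 0" using that e by auto
        have "((\<lambda>r. 1 / r) has_real_derivative - (1 / r\<^sup>2)) (at r)"
          using r by (auto intro!: derivative_eq_intros simp: power2_eq_square)
        from DERIV_chain2[OF Df[of "1 / r"] this] r
        have "((\<lambda>r. f (1 / r)) has_real_derivative deriv f (1 / r) * - (1 / r\<^sup>2)) (at r)" by simp
        then show ?thesis unfolding G_def
          by (auto intro!: derivative_eq_intros)
      qed
      have "continuous_on {e..r1} (\<lambda>r. deriv f (1 / r))"
        using e by (intro continuous_on_compose2[OF cf]) (auto intro!: continuous_intros)
      then show "continuous_on {e..r1} (\<lambda>r. 2 * L * deriv f (1 / r) / r\<^sup>2)"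
        using e by (auto intro!: continuous_intros)
      show "0 \<le> 2 * L * deriv f (1 / r) / r\<^sup>2" if "r \<in> {e..r1}" for r
        using that e L pos[of "1 / r"] by auto
    qed fact
    also have "\<dots> = (\<integral>\<^sup>+r. ennreal (F (- G r)) * ennreal (2 * L * deriv f (1 / r) / r\<^sup>2) * indicator {e..r1} r \<partial>lborel)"
    proof (rule nn_integral_cong)
      fix r :: real
      have "F (- G r) \<ge> 0" by (simp add: F_def M0(2))
      then have "ennreal (F (- G r) * (2 * L * deriv f (1 / r) / r\<^sup>2))
          = ennreal (F (- G r)) * ennreal (2 * L * deriv f (1 / r) / r\<^sup>2)"
        by (rule ennreal_mult')
      then show "ennreal (F (- G r) * (2 * L * deriv f (1 / r) / r\<^sup>2) * indicator {e..r1} r)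
          = ennreal (F (- G r)) * ennreal (2 * L * deriv f (1 / r) / r\<^sup>2) * indicator {e..r1} r"
        by (simp only: indicator_def if_distrib[of ennreal] split: if_split) simp
    qed
    also have "(\<integral>\<^sup>+x. ennreal (F (- x) * indicator {G e..G r1} x) \<partial>lborel)
        = (\<integral>\<^sup>+x. ennreal (F (- x)) * indicator {G e..G r1} x \<partial>lborel)"
      by (rule nn_integral_cong) (auto simp: indicator_def)
    finally show ?thesis .
  qed
  also have "\<dots> = (\<integral>\<^sup>+r. ennreal (2 * L) * (ennreal (M0 r / r\<^sup>2 * deriv f (1 / r)) * indicator {e..r1} r) \<partial>lborel)"
  proof (rule nn_integral_cong)
    fix r :: real
    show "ennreal (F (- G r)) * ennreal (2 * L * deriv f (1 / r) / r\<^sup>2) * indicator {e..r1} r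
      = ennreal (2 * L) * (ennreal (M0 r / r\<^sup>2 * deriv f (1 / r)) * indicator {e..r1} r)"
    proof (cases "r \<in> {e..r1}")
      case True
      then have r: "r > 0" using e by auto
      have "F (- G r) = M0 r"
        using L r by (simp add: F_def G_def inv_above_eq[OF mf])
      moreover have "ennreal (M0 r) * ennreal (2 * L * deriv f (1 / r) / r\<^sup>2)
          = ennreal (2 * L) * ennreal (M0 r / r\<^sup>2 * deriv f (1 / r))"
        using M0(2)[of r] L by (simp add: ennreal_mult'[symmetric] ac_simps)
      ultimately show ?thesis using True by simp
    qed simp
  qed
  also have "\<dots> = ennreal (2 * L) * (\<integral>\<^sup>+r. ennreal (M0 r / r\<^sup>2 * deriv f (1 / r)) * indicator {e..r1} r \<partial>lborel)"
  proof (rule nn_integral_cmult)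
    \<comment> \<open>Continuity of \<open>deriv f\<close> is known only on \<open>{0<..}\<close>,
      so the function is cut off outside \<open>{e..r1}\<close> to obtain measurability on the whole
      line.\<close>
    have "(\<lambda>r. if r \<in> {e..r1} then deriv f (1 / r) else 0) \<in> borel_measurable borel"
      using e by (intro borel_measurable_continuous_on_if continuous_on_compose2[OF cf]) (auto intro!: continuous_intros)
    then have "(\<lambda>r. ennreal (M0 r / r\<^sup>2 * (if r \<in> {e..r1} then deriv f (1 / r) else 0)) * indicator {e..r1} r)
      \<in> borel_measurable borel" by measurable
    also have "(\<lambda>r. ennreal (M0 r / r\<^sup>2 * (if r \<in> {e..r1} then deriv f (1 / r) else 0)) * indicator {e..r1} r)
      = (\<lambda>r. ennreal (M0 r / r\<^sup>2 * deriv f (1 / r)) * indicator {e..r1} r)"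
      by (auto simp: indicator_def)
    finally show "(\<lambda>r. ennreal (M0 r / r\<^sup>2 * deriv f (1 / r)) * indicator {e..r1} r) \<in> borel_measurable lborel"
      by simp
  qed
  also have "(\<integral>\<^sup>+x. ennreal (F (- x)) * indicator {G e..G r1} x \<partial>lborel)
      = (\<integral>\<^sup>+s. ennreal (F s) * indicator {- G r1..- G e} s \<partial>lborel)"
    by (subst nn_integral_real_affine[where c = "-1" and t = 0])
      (auto intro!: nn_integral_cong simp: indicator_def)
  finally show ?thesis by (simp add: F_def G_def)
qed

text \<open>The constants are fixed in the order \<open>\<tau>\<close>, \<open>r1\<close>,
  \<open>T\<close>, \<open>\<eta>\<close>: the tail of the integral up to \<open>2 * r1\<close> is
  below \<open>\<tau>\<close>, \<open>T\<close> is the time matching radius \<open>r1\<close>, and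
  \<open>\<eta>\<close> makes \<open>M_fun\<close> small enough over times up to \<open>T\<close>.
  None of them depends on the curve or its duration.\<close>

lemma local_visibility:
  fixes \<Omega> U :: "(complex ^ 'd) set" and f :: "real \<Rightarrow> real"
  assumes \<Omega>: "open \<Omega>" "connected \<Omega>" "bounded \<Omega>"
    and U: "open U" "q \<in> U" "q \<in> frontier \<Omega>" and z0: "z0 \<in> \<Omega>"
    and df: "f differentiable_on {0<..}" and cf: "continuous_on {0<..} (deriv f)"
    and mf: "strict_mono_on {0<..} f" and ff: "filterlim f at_top at_top"
    and kf: "\<And>z. z \<in> \<Omega> \<inter> U \<Longrightarrow> kobayashi_dist \<Omega> z0 z \<le> f (1 / bdist \<Omega> z)"
    and M: "(M_fun \<Omega> U \<longlongrightarrow> 0) (at_right 0)"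
    and r0: "r0 > 0" and fin: "(\<integral>\<^sup>+ r\<in>{0<..<r0}. ennreal (M_fun \<Omega> U r / r\<^sup>2 * deriv f (1 / r)) \<partial>lborel) < \<infinity>"
    and L: "L \<ge> 1" and \<rho>: "\<rho> > 0"
  obtains \<eta> where "\<eta> > 0" "\<And>a b \<sigma>. a \<le> b \<Longrightarrow> almost_geodesic \<Omega> L \<kappa> {a..b} \<sigma> \<Longrightarrow> \<sigma> ` {a..b} \<subseteq> U \<Longrightarrow>
    (\<And>t. t \<in> {a..b} \<Longrightarrow> bdist \<Omega> (\<sigma> t) < \<eta>) \<Longrightarrow> norm (\<sigma> b - \<sigma> a) < \<rho>"
proof -
  \<comment> \<open>Extension by 0 makes the function monotone, hence Borel, on the whole
    line.\<close>
  define M0 where "M0 = (\<lambda>r. if r > 0 then M_fun \<Omega> U r else 0)"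
  have near: "\<exists>z \<in> U \<inter> \<Omega>. bdist \<Omega> z \<le> r" if "r > 0" for r
    by (rule points_near_frontier[OF U that])
  have M0_nonneg: "0 \<le> M0 r" for r
    using near[of r] M_fun_nonneg[OF \<Omega>(1,3)] by (auto simp: M0_def)
  have M0_mono: "mono M0"
  proof (rule monoI)
    fix r s :: real assume "r \<le> s"
    then show "M0 r \<le> M0 s"
      using near[of r] M_fun_mono[OF \<Omega>(1,3), of _ U r s] M0_nonneg[of s] by (auto simp: M0_def)
  qed
  have [measurable]: "M0 \<in> borel_measurable borel" "inv_above f \<in> borel_measurable borel"
    using M0_mono inv_above_mono[OF ff] by (auto intro: borel_measurable_mono)
  define \<Phi> where "\<Phi> = (\<lambda>r. M0 r / r\<^sup>2 * (if r \<in> {0<..} then deriv f (1 / r) else 0))"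
  have \<Phi>[measurable]: "\<Phi> \<in> borel_measurable borel"
  proof -
    have "continuous_on {0<..} (\<lambda>r. deriv f (1 / r))"
      by (intro continuous_on_compose2[OF cf]) (auto intro!: continuous_intros)
    then have "(\<lambda>r. if r \<in> {0<..} then deriv f (1 / r) else 0) \<in> borel_measurable borel"
      by (intro borel_measurable_continuous_on_if) auto
    then show ?thesis unfolding \<Phi>_def by measurable
  qed
  have "(\<integral>\<^sup>+ r\<in>{0<..<r0}. ennreal (\<Phi> r) \<partial>lborel) < \<infinity>"
  proof -
    have "(\<integral>\<^sup>+ r\<in>{0<..<r0}. ennreal (\<Phi> r) \<partial>lborel)
      = (\<integral>\<^sup>+ r\<in>{0<..<r0}. ennreal (M_fun \<Omega> U r / r\<^sup>2 * deriv f (1 / r)) \<partial>lborel)"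
      by (rule nn_integral_cong) (auto simp: indicator_def \<Phi>_def M0_def)
    then show ?thesis using fin by simp
  qed
  note lim = nn_integral_tail_tendsto_0[OF \<Phi> r0 this]
  \<comment> \<open>In the final estimate the tail costs
    \<open>2 * L * (2 * L * \<tau>) = \<rho> / 2\<close>, while times up to \<open>T\<close> cost
    less than \<open>\<rho> / 4\<close> by the choice of \<open>\<eta>\<close>.\<close>
  define \<tau> where "\<tau> = \<rho> / (8 * L\<^sup>2)"
  have \<tau>: "\<tau> > 0" using \<rho> L by (simp add: \<tau>_def)
  have "eventually (\<lambda>n. (\<integral>\<^sup>+ r\<in>{0<..<r0 / Suc n}. ennreal (\<Phi> r) \<partial>lborel) < ennreal \<tau>) sequentially"
    using lim by (rule order_tendstoD) (use \<tau> in simp)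
  moreover have "eventually (\<lambda>n. \<kappa>' < f (2 * Suc n / r0)) sequentially" for \<kappa>'
  proof -
    have "filterlim (\<lambda>n. 2 * real (Suc n) / r0) at_top sequentially"
    proof -
      have "filterlim (\<lambda>n. (2 / r0) * real (Suc n)) at_top sequentially"
        using r0 by (intro filterlim_tendsto_pos_mult_at_top[OF tendsto_const] 
            filterlim_compose[OF filterlim_real_sequentially filterlim_Suc]) auto
      then show ?thesis by (simp add: field_simps)
    qed
    from filterlim_compose[OF ff this] show ?thesis by (simp add: filterlim_at_top_dense)
  qed
  ultimately have "eventually (\<lambda>n. (\<integral>\<^sup>+ r\<in>{0<..<r0 / Suc n}. ennreal (\<Phi> r) \<partial>lborel) < ennreal \<tau>
      \<and> max 0 (- \<kappa>) < f (2 * Suc n / r0)) sequentially"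
    by (intro eventually_conj)
  then obtain n where n: "(\<integral>\<^sup>+ r\<in>{0<..<r0 / Suc n}. ennreal (\<Phi> r) \<partial>lborel) < ennreal \<tau>" "max 0 (- \<kappa>) < f (2 * Suc n / r0)"
    using eventually_happens[of _ sequentially] by auto
  define r2 where "r2 = r0 / Suc n"
  \<comment> \<open>Halving puts the closed interval \<open>{e..r1}\<close> inside the open interval
    \<open>{0<..<r2}\<close> of the tail estimate.\<close>
  define r1 where "r1 = r2 / 2"
  have "r2 > 0" using r0 by (simp add: r2_def)
  then have r12: "0 < r1" "r1 < r2" by (simp_all add: r1_def)
  have fr1: "f (1 / r1) > 0" "f (1 / r1) + \<kappa> > 0"
  proof -
    have "1 / r1 = 2 * Suc n / r0" by (simp add: r1_def r2_def)
    then have "max 0 (- \<kappa>) < f (1 / r1)" using n(2) by simp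
    then show "f (1 / r1) > 0" "f (1 / r1) + \<kappa> > 0" by auto
  qed
  define T where "T = L * (2 * f (1 / r1) + \<kappa>)"
  have T: "T > 0" using L fr1 by (auto simp: T_def intro!: mult_pos_pos)
  have "eventually (\<lambda>r. M_fun \<Omega> U r < \<rho> / (8 * L * T)) (at_right 0)"
    using M by (rule order_tendstoD) (use \<rho> L T in simp)
  then obtain \<eta>' where \<eta>': "\<eta>' > 0" "\<And>r. 0 < r \<Longrightarrow> r < \<eta>' \<Longrightarrow> M_fun \<Omega> U r < \<rho> / (8 * L * T)"
    unfolding eventually_at_right_field by auto
  define \<eta> where "\<eta> = \<eta>' / 2"
  have \<eta>: "\<eta> > 0" "M0 \<eta> < \<rho> / (8 * L * T)" using \<eta>' by (auto simp: \<eta>_def M0_def)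
  define F where "F = (\<lambda>s. M0 (1 / inv_above f ((s / L - \<kappa>) / 2)))"
  \<comment> \<open>A majorant of \<open>L * M_fun\<close> along the curve as a function of
    \<open>s = |t - c|\<close>: constant up to time \<open>T\<close>, and given by the inverse of
    \<open>f\<close> afterwards.\<close>
  define g where "g = (\<lambda>s. L * (if s \<le> T then M0 \<eta> else F s))"
  have [measurable]: "F \<in> borel_measurable borel" "g \<in> borel_measurable borel"
    unfolding F_def g_def by measurable
  have F0: "F s \<ge> 0" for s by (simp add: F_def M0_nonneg)
  have g0: "g s \<ge> 0" for s using L by (simp add: g_def F0 M0_nonneg)
  show ?thesis
  proof (rule that[OF \<eta>(1)])
    fix a b :: real and \<sigma>
    assume ab: "a \<le> b" and ag: "almost_geodesic \<Omega> L \<kappa> {a..b} \<sigma>" and \<sigma>U: "\<sigma> ` {a..b} \<subseteq> U"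
      and small: "\<And>t. t \<in> {a..b} \<Longrightarrow> bdist \<Omega> (\<sigma> t) < \<eta>"
    have \<sigma>\<Omega>: "\<sigma> t \<in> \<Omega>" if "t \<in> {a..b}" for t using ag that by (auto simp: almost_geodesic_def)
    define D where "D = (\<lambda>t. bdist \<Omega> (\<sigma> t))"
    have D0: "D t > 0" if "t \<in> {a..b}" for t
      unfolding D_def by (rule bdist_pos[OF \<Omega>(1,3) \<sigma>\<Omega>[OF that]])
    have "continuous_on {a..b} \<sigma>"
      using ag by (intro abs_cont_on_imp_continuous_on) (simp add: almost_geodesic_def)
    then have "continuous_on {a..b} D"
      unfolding D_def bdist_def by (intro continuous_on_infdist)
    then obtain c where c: "c \<in> {a..b}" "\<And>t. t \<in> {a..b} \<Longrightarrow> D t \<le> D c"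
      using continuous_attains_sup[of "{a..b}" D] ab by auto
    have far: "\<bar>t - c\<bar> / L - \<kappa> \<le> 2 * f (1 / D t)" if t: "t \<in> {a..b}" for t
    proof -
      have "\<bar>t - c\<bar> / L - \<kappa> \<le> kobayashi_dist \<Omega> (\<sigma> t) (\<sigma> c)"
        using ag t c(1) by (simp add: almost_geodesic_def)
      also have "\<dots> \<le> kobayashi_dist \<Omega> (\<sigma> t) z0 + kobayashi_dist \<Omega> z0 (\<sigma> c)"
        using t c(1) by (intro kobayashi_dist_triangle \<Omega> \<sigma>\<Omega> z0)
      also have "\<dots> \<le> f (1 / D t) + f (1 / D c)"
        unfolding kobayashi_dist_commute[of \<Omega> "\<sigma> t" z0] D_def
        using t c(1) \<sigma>\<Omega> \<sigma>U by (intro add_mono kf) auto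
      \<comment> \<open>Maximality of \<open>D\<close> at \<open>c\<close> absorbs the second
        summand into the first.\<close>
      also have "f (1 / D c) \<le> f (1 / D t)"
      proof -
        have "1 / D c \<le> 1 / D t"
          using c(2)[OF t] by (intro divide_left_mono mult_pos_pos D0 c(1) t) simp_all
        then show ?thesis
          using strict_mono_on_leD[OF mf, of "1 / D c" "1 / D t"] D0[OF t] D0[OF c(1)] by simp
      qed
      finally show ?thesis by simp
    qed
    have gM: "L * M_fun \<Omega> U (bdist \<Omega> (\<sigma> t)) \<le> g \<bar>t - c\<bar>" if t: "t \<in> {a..b}" for t
    proof -
      have "M0 (D t) \<le> (if \<bar>t - c\<bar> \<le> T then M0 \<eta> else F \<bar>t - c\<bar>)"
      proof (cases "\<bar>t - c\<bar> \<le> T")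
        case True
        then show ?thesis using small[OF t] by (auto simp: D_def intro!: monoD[OF M0_mono])
      next
        case False
        define y where "y = (\<bar>t - c\<bar> / L - \<kappa>) / 2"
        have "2 * f (1 / r1) + \<kappa> < \<bar>t - c\<bar> / L"
          using False L by (simp add: T_def pos_less_divide_eq mult.commute)
        then have "f (1 / r1) \<le> y" by (simp add: y_def)
        then have "inv_above f (f (1 / r1)) \<le> inv_above f y"
          by (rule monoD[OF inv_above_mono[OF ff]])
        \<comment> \<open>Positivity of \<open>inv_above f y\<close>, which is at least
          \<open>1 / r1\<close>, permits taking reciprocals in the bound for
          \<open>1 / D t\<close>.\<close>
        then have pos: "inv_above f y > 0"
          using inv_above_eq[OF mf, of "1 / r1"] r12 by (metis less_le_trans zero_less_divide_1_iff)
        have "inv_above f y \<le> 1 / D t"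
          using far[OF t] D0[OF t] by (intro inv_above_le) (simp_all add: y_def)
        then have "D t \<le> 1 / inv_above f y"
          using pos D0[OF t] by (simp add: field_simps)
        then have "M0 (D t) \<le> F \<bar>t - c\<bar>"
          unfolding F_def y_def[symmetric] by (rule monoD[OF M0_mono])
        then show ?thesis using False by simp
      qed
      moreover have "M_fun \<Omega> U (bdist \<Omega> (\<sigma> t)) = M0 (D t)"
        using D0[OF t] by (simp add: M0_def D_def)
      ultimately show ?thesis using L unfolding g_def by (intro mult_left_mono) auto
    qed
    define u where "u = (b - a) / L"
    \<comment> \<open>A large \<open>x = 1 / e\<close> ensures that the time \<open>S\<close>
      matching radius \<open>e\<close> is at least \<open>b - a\<close> and at least
      \<open>T\<close>.\<close>
    have "eventually (\<lambda>x. 1 / r1 \<le> x \<and> max (u / 2 - \<kappa> / 2) (f (1 / r1)) \<le> f x) at_top"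
      using ff unfolding filterlim_at_top by (intro eventually_conj eventually_ge_at_top) blast
    then obtain x where x: "1 / r1 \<le> x" "max (u / 2 - \<kappa> / 2) (f (1 / r1)) \<le> f x"
      using eventually_happens[of _ "at_top :: real filter"] by auto
    define e where "e = 1 / x"
    have x0: "x > 0" using x(1) r12(1) by (meson less_le_trans zero_less_divide_1_iff)
    have e: "0 < e" "e \<le> r1" "1 / e = x"
      using x0 x(1) r12(1) by (auto simp: e_def field_simps)
    define S where "S = L * (2 * f (1 / e) + \<kappa>)"
    have S: "b - a \<le> S" "T \<le> S"
    proof -
      have "u \<le> 2 * f (1 / e) + \<kappa>" using x(2) e(3) by simp
      then show "b - a \<le> S" using L by (simp add: u_def S_def pos_divide_le_eq mult.commute)
      show "T \<le> S" using x(2) e(3) L by (simp add: S_def T_def)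
    qed
    have "(\<integral>\<^sup>+s. ennreal (F s) * indicator {T..S} s \<partial>lborel)
      = ennreal (2 * L) * (\<integral>\<^sup>+r. ennreal (M0 r / r\<^sup>2 * deriv f (1 / r)) * indicator {e..r1} r \<partial>lborel)"
      unfolding F_def T_def S_def
      by (rule inverse_time_substitution[OF df cf mf ff M0_mono M0_nonneg _ e(1,2)]) (use L in simp)
    also have "\<dots> \<le> ennreal (2 * L) * (\<integral>\<^sup>+ r\<in>{0<..<r2}. ennreal (\<Phi> r) \<partial>lborel)"
      using e(1) r12 by (intro mult_left_mono nn_integral_mono) (auto simp: indicator_def \<Phi>_def)
    also have "\<dots> \<le> ennreal (2 * L) * ennreal \<tau>"
      using n(1) by (intro mult_left_mono) (auto simp: r2_def)
    also have "\<dots> = ennreal (2 * L * \<tau>)" using L by (simp add: ennreal_mult'[symmetric])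
    finally have tail: "(\<integral>\<^sup>+s. ennreal (F s) * indicator {T..S} s \<partial>lborel) \<le> ennreal (2 * L * \<tau>)" .
    \<comment> \<open>Both indicators on the right contain \<open>T\<close>; the overlap only
      enlarges that side.\<close>
    have "(\<integral>\<^sup>+s. ennreal (g s) * indicator {0..S} s \<partial>lborel)
      \<le> (\<integral>\<^sup>+s. ennreal (L * M0 \<eta>) * indicator {0..T} s + ennreal L * (ennreal (F s) * indicator {T..S} s) \<partial>lborel)"
      using L M0_nonneg F0 S by (intro nn_integral_mono) (auto simp: indicator_def g_def ennreal_mult')
    also have "\<dots> = ennreal (L * M0 \<eta>) * ennreal T + ennreal L * (\<integral>\<^sup>+s. ennreal (F s) * indicator {T..S} s \<partial>lborel)"
      using T by (subst nn_integral_add) (auto simp: nn_integral_cmult nn_integral_cmult_indicator)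
    also have "\<dots> \<le> ennreal (L * M0 \<eta>) * ennreal T + ennreal L * ennreal (2 * L * \<tau>)"
      by (intro add_left_mono mult_left_mono tail) auto
    also have "\<dots> = ennreal (L * M0 \<eta> * T + L * (2 * L * \<tau>))"
      using L T \<tau> M0_nonneg[of \<eta>] by (simp add: ennreal_mult'[symmetric] ennreal_plus[symmetric] del: ennreal_plus)
    finally have g_int: "(\<integral>\<^sup>+s. ennreal (g s) * indicator {0..S} s \<partial>lborel) \<le> ennreal (L * M0 \<eta> * T + L * (2 * L * \<tau>))" .
    have bound: "2 * (L * M0 \<eta> * T + L * (2 * L * \<tau>)) < \<rho>"
    proof -
      have "M0 \<eta> * (8 * L * T) < \<rho>"
        using \<eta>(2) L T by (simp add: pos_less_divide_eq)
      moreover have "8 * L\<^sup>2 * \<tau> = \<rho>" using L by (simp add: \<tau>_def)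
      ultimately have "8 * (L * M0 \<eta> * T) < \<rho>" "8 * (L * (L * \<tau>)) = \<rho>"
        by (simp_all add: ac_simps power2_eq_square)
      then show ?thesis using \<rho> by (simp add: algebra_simps)
    qed
    have "(\<integral>\<^sup>+t. ennreal (g \<bar>t - c\<bar>) * indicator {a..b} t \<partial>lborel)
      \<le> 2 * (\<integral>\<^sup>+s. ennreal (g s) * indicator {0..S} s \<partial>lborel)"
      by (rule nn_integral_radial_le[OF _ c(1) S(1)]) simp
    also have "\<dots> \<le> 2 * ennreal (L * M0 \<eta> * T + L * (2 * L * \<tau>))"
      by (intro mult_left_mono g_int) auto
    also have "\<dots> = ennreal (2 * (L * M0 \<eta> * T + L * (2 * L * \<tau>)))"
      by (simp add: ennreal_mult'[symmetric] ennreal_numeral[symmetric] del: ennreal_numeral)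
    also have "\<dots> < ennreal \<rho>"
      using bound \<rho> by (intro ennreal_lessI)
    finally have "(\<integral>\<^sup>+t. ennreal (g \<bar>t - c\<bar>) * indicator {a..b} t \<partial>lborel) < ennreal \<rho>" .
    then show "norm (\<sigma> b - \<sigma> a) < \<rho>"
      using L by (intro almost_geodesic_displacement[OF \<Omega>(1,3) ag ab _ \<sigma>U _ _ gM]) (auto simp: g0)
  qed
qed

subsection \<open>Visibility of the domain\<close>

text \<open>\<open>e\<close> is the least time at which \<open>h\<close> equals
  \<open>\<rho>\<close>. A larger value before \<open>e\<close> would, by the intermediate value
  theorem, produce an earlier such time.\<close>

lemma first_exit:
  fixes h :: "real \<Rightarrow> real"
  assumes cont: "continuous_on {c..b} h" and "c \<le> b" "h c \<le> \<rho>" "\<rho> \<le> h b"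
  obtains e where "e \<in> {c..b}" "h e = \<rho>" "\<And>t. t \<in> {c..e} \<Longrightarrow> h t \<le> \<rho>"
proof -
  define A where "A = {t \<in> {c..b}. h t = \<rho>}"
  have "compact A"
  proof -
    have "A = {c..b} \<inter> h -` {\<rho>}" by (auto simp: A_def)
    then have "closed A" using continuous_closed_preimage[OF cont] by simp
    then show ?thesis
      by (rule compact_eq_bounded_closed[THEN iffD2, OF conjI, rotated])
        (rule bounded_subset[of "{c..b}"], auto simp: A_def)
  qed
  moreover have "A \<noteq> {}"
    using IVT'[of h c \<rho> b] assms by (auto simp: A_def)
  ultimately obtain e where e: "e \<in> A" "\<And>t. t \<in> A \<Longrightarrow> e \<le> t"
    using compact_attains_inf[of A] by blast
  have "h t \<le> \<rho>" if t: "t \<in> {c..e}" for t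
  proof (rule ccontr)
    assume gt: "\<not> h t \<le> \<rho>"
    have "continuous_on {c..t} h"
      using e t by (intro continuous_on_subset[OF cont]) (auto simp: A_def)
    then obtain t' where t': "c \<le> t'" "t' \<le> t" "h t' = \<rho>"
      using IVT'[of h c \<rho> t] gt t assms(3) by auto
    then have "t' \<in> A" using e t by (auto simp: A_def)
    then have "t' = t" using e(2) t' t by force
    then show False using t' gt by simp
  qed
  then show ?thesis using that e(1) by (auto simp: A_def)
qed

text \<open>On the frontier the distance vanishes, so the set equals a closed subset of the compact
  set \<open>closure \<Omega>\<close>. These sets serve as an exhaustion of
  \<open>\<Omega>\<close>.\<close>

lemma compact_bdist_ge:
  fixes \<Omega> :: "(complex ^ 'd) set"
  assumes "open \<Omega>" "bounded \<Omega>" "c > 0"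
  shows "compact {z \<in> \<Omega>. c \<le> bdist \<Omega> z}"
proof -
  have eq: "{z \<in> \<Omega>. c \<le> bdist \<Omega> z} = closure \<Omega> \<inter> {z. c \<le> infdist z (frontier \<Omega>)}"
  proof (intro equalityI subsetI)
    fix z assume z: "z \<in> closure \<Omega> \<inter> {z. c \<le> infdist z (frontier \<Omega>)}"
    then have "z \<notin> frontier \<Omega>" using assms(3) by auto
    then have "z \<in> \<Omega>" using z assms(1) by (auto simp: frontier_def interior_open)
    then show "z \<in> {z \<in> \<Omega>. c \<le> bdist \<Omega> z}" using z by (simp add: bdist_def)
  qed (use closure_subset in \<open>auto simp: bdist_def\<close>)
  have "closed {z. c \<le> infdist z (frontier \<Omega>)}"
    by (intro closed_Collect_le continuous_intros)
  then show ?thesis unfolding eq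
    using assms(2) by (intro compact_Int_closed) (simp_all add: compact_closure)
qed

theorem theorem1p3:
  fixes \<Omega> E :: "(complex ^ 'd) set"
  assumes "open \<Omega>" and "connected \<Omega>" and "\<Omega> \<noteq> {}" and "bounded \<Omega>"
    and "closed E" and "E \<subseteq> frontier \<Omega>"
    and "\<And>p q. p \<in> frontier \<Omega> \<Longrightarrow> q \<in> frontier \<Omega> \<Longrightarrow> p \<noteq> q \<Longrightarrow>
           \<exists>p'\<in>frontier \<Omega>. \<exists>r>0.
             p \<in> ball p' r \<and> q \<in> frontier \<Omega> - closure (ball p' r) \<and>
             E \<inter> frontier (ball p' r) = {}"
    and "\<And>q'. q' \<in> frontier \<Omega> - E \<Longrightarrow>
           \<exists>U z0. \<exists>f :: real \<Rightarrow> real.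
             open U \<and> q' \<in> U \<and> z0 \<in> \<Omega> \<and>
             f differentiable_on {0<..} \<and> continuous_on {0<..} (deriv f) \<and>
             strict_mono_on {0<..} f \<and> filterlim f at_top at_top \<and>
             (\<forall>z\<in>\<Omega> \<inter> U. kobayashi_dist \<Omega> z0 z \<le> f (1 / bdist \<Omega> z)) \<and>
             (M_fun \<Omega> U \<longlongrightarrow> 0) (at_right 0) \<and>
             (\<exists>r0>0. (\<integral>\<^sup>+ r\<in>{0<..<r0}. ennreal (M_fun \<Omega> U r / r\<^sup>2 * deriv f (1 / r)) \<partial>lborel) < \<infinity>)"
  shows "visibility_domain \<Omega>"
  unfolding visibility_domain_def visibility_domain_wrt_def
proof (intro allI impI conjI ballI)
  fix L \<kappa> :: real and x y assume "1 \<le> L" "0 < \<kappa>" "x \<in> \<Omega>" "y \<in> \<Omega>"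
  then show "\<exists>a b \<sigma>. a \<le> b \<and> almost_geodesic \<Omega> L \<kappa> {a..b} \<sigma> \<and> \<sigma> a = x \<and> \<sigma> b = y"
    using assms by (intro almost_geodesic_exists)
next
  fix L \<kappa> :: real and p q assume L: "1 \<le> L" and \<kappa>: "0 < \<kappa>"
    and p: "p \<in> frontier \<Omega>" and q: "q \<in> frontier \<Omega>" and pq: "p \<noteq> q"
  obtain p' r where p': "p \<in> ball p' r" "q \<notin> closure (ball p' r)" "E \<inter> frontier (ball p' r) = {}" "r > 0"
    using assms(7)[OF p q pq] by blast
  have fr: "frontier (ball p' r) = sphere p' r" and cl: "closure (ball p' r) = cball p' r"
    using p'(4) by simp_all
  \<comment> \<open>The first term keeps the closed balls about \<open>p\<close> and
    \<open>q\<close> disjoint; the other two put the open ball about \<open>p\<close> inside the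
    sphere around \<open>p'\<close> and the one about \<open>q\<close> outside it.\<close>
  define d where "d = min (dist p q / 3) (min (r - dist p' p) (dist p' q - r))"
  have d: "d > 0" "d \<le> dist p q / 3" "d \<le> r - dist p' p" "d \<le> dist p' q - r"
  proof -
    have "0 < dist p q / 3" "0 < r - dist p' p" "0 < dist p' q - r"
      using p' pq unfolding cl by simp_all
    then show "d > 0" unfolding d_def by simp
  qed (unfold d_def, linarith+)
  let ?V = "\<lambda>n::nat. ball p (d / Suc n)" and ?W = "\<lambda>n::nat. ball q (d / Suc n)"
  let ?K = "\<lambda>n::nat. {z \<in> \<Omega>. 1 / Suc n \<le> bdist \<Omega> z}"
  have dn: "0 < d / Suc n" "d / Suc n \<le> d" for n
    using d(1) by (auto simp: divide_le_eq)
  show "\<exists>V W K. open V \<and> p \<in> V \<and> open W \<and> q \<in> W \<and> closure V \<inter> closure W = {} \<and>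
           compact K \<and> K \<subseteq> \<Omega> \<and>
           (\<forall>a b \<sigma>. a \<le> b \<and> almost_geodesic \<Omega> L \<kappa> {a..b} \<sigma> \<and> \<sigma> a \<in> V \<and> \<sigma> b \<in> W
              \<longrightarrow> \<sigma> ` {a..b} \<inter> K \<noteq> {})" (is "?vis")
  proof (rule ccontr)
    assume nvis: "\<not> ?vis"
    \<comment> \<open>A curve violating visibility for the \<open>n\<close>-th triple, in which the
      neighbourhoods shrink to \<open>p\<close> and \<open>q\<close> while the compact sets exhaust
      \<open>\<Omega>\<close>.\<close>
    define bad where "bad = (\<lambda>n a b \<sigma>. a \<le> b \<and> almost_geodesic \<Omega> L \<kappa> {a..b} \<sigma> \<and>
      \<sigma> a \<in> ?V n \<and> \<sigma> b \<in> ?W n \<and> \<sigma> ` {a..b} \<inter> ?K n = {})"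
    have "\<exists>a b \<sigma>. bad n a b \<sigma>" for n
    proof (rule ccontr)
      assume neg: "\<not> (\<exists>a b \<sigma>. bad n a b \<sigma>)"
      have "closure (?V n) \<inter> closure (?W n) = {}"
      proof -
        have "False" if "z \<in> cball p (d / Suc n)" "z \<in> cball q (d / Suc n)" for z
        proof -
          have "dist p z \<le> dist p q / 3" "dist q z \<le> dist p q / 3"
            using that dn[of n] d(2) by auto
          then have "dist p q \<le> dist p q / 3 + dist p q / 3"
            using dist_triangle2[of p q z] by linarith
          then show False using pq by simp
        qed
        then show ?thesis using dn(1)[of n] by (auto simp: closure_ball)
      qed
      moreover have "compact (?K n)"
        by (rule compact_bdist_ge[OF assms(1,4)]) simp
      moreover have "\<forall>a b \<sigma>. a \<le> b \<and> almost_geodesic \<Omega> L \<kappa> {a..b} \<sigma> \<and> \<sigma> a \<in> ?V n \<and> \<sigma> b \<in> ?W n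
              \<longrightarrow> \<sigma> ` {a..b} \<inter> ?K n \<noteq> {}"
        using neg unfolding bad_def by blast
      moreover have "p \<in> ?V n" "q \<in> ?W n" using dn(1)[of n] by simp_all
      moreover have "?K n \<subseteq> \<Omega>" by blast
      ultimately have ?vis
        by (intro exI[of _ "?V n"] exI[of _ "?W n"] exI[of _ "?K n"] conjI open_ball)
      then show False using nvis by blast
    qed
    then obtain a b \<sigma> where bad: "\<And>n. bad n (a n) (b n) (\<sigma> n)"
      by metis
    have ab: "a n \<le> b n" and ag: "almost_geodesic \<Omega> L \<kappa> {a n..b n} (\<sigma> n)"
      and \<sigma>a: "\<sigma> n (a n) \<in> ?V n" and \<sigma>b: "\<sigma> n (b n) \<in> ?W n"
      and \<sigma>K: "\<sigma> n ` {a n..b n} \<inter> ?K n = {}" for n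
      using bad[of n] unfolding bad_def by blast+
    have cont: "continuous_on {a n..b n} (\<sigma> n)" for n
      using ag[of n] by (intro abs_cont_on_imp_continuous_on) (simp add: almost_geodesic_def)
    have in\<Omega>: "\<sigma> n t \<in> \<Omega>" if "t \<in> {a n..b n}" for n t
      using ag[of n] that by (auto simp: almost_geodesic_def)
    have small: "bdist \<Omega> (\<sigma> n t) < 1 / Suc n" if "t \<in> {a n..b n}" for n t
      using \<sigma>K[of n] in\<Omega>[OF that] that by force
    have "\<exists>c\<in>{a n..b n}. dist p' (\<sigma> n c) = r" for n
    proof -
      have "continuous_on {a n..b n} (\<lambda>t. dist p' (\<sigma> n t))"
        by (intro continuous_intros cont)
      moreover have "dist p' (\<sigma> n (a n)) \<le> r"
        using \<sigma>a[of n] dn(2)[of n] d(3) dist_triangle[of p' "\<sigma> n (a n)" p] by simp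
      moreover have "r \<le> dist p' (\<sigma> n (b n))"
        using \<sigma>b[of n] dn(2)[of n] d(4) dist_triangle2[of p' q "\<sigma> n (b n)"] by simp
      ultimately show ?thesis
        using first_exit[of "a n" "b n" "\<lambda>t. dist p' (\<sigma> n t)" r] ab[of n] by metis
    qed
    then obtain c where c: "\<And>n. c n \<in> {a n..b n}" "\<And>n. dist p' (\<sigma> n (c n)) = r" by metis
    \<comment> \<open>The crossing points subconverge to some \<open>q'\<close>. It lies on the
      sphere, hence off \<open>E\<close>, and in the frontier because the boundary distances tend to
      0.\<close>
    have "compact (closure \<Omega>)" using assms(4) by (simp add: compact_closure)
    moreover have "\<sigma> n (c n) \<in> closure \<Omega>" for n
      using in\<Omega>[OF c(1)] closure_subset by blast
    ultimately obtain q' s where s: "strict_mono s" "((\<lambda>n. \<sigma> n (c n)) \<circ> s) \<longlonglongrightarrow> q'"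
      unfolding compact_def by metis
    have "dist p' q' = r"
    proof -
      have "(\<lambda>n. dist p' (((\<lambda>n. \<sigma> n (c n)) \<circ> s) n)) \<longlonglongrightarrow> dist p' q'"
        by (intro tendsto_intros s)
      then show ?thesis using c(2) by (simp add: LIMSEQ_const_iff)
    qed
    then have "q' \<notin> E" using p'(3) fr by auto
    have inv0: "(\<lambda>n. 1 / real (Suc (s n))) \<longlonglongrightarrow> 0"
      using LIMSEQ_subseq_LIMSEQ[OF LIMSEQ_Suc[OF lim_1_over_n] s(1)] by (simp add: o_def)
    have "q' \<in> frontier \<Omega>"
    proof -
      have "(\<lambda>n. infdist (((\<lambda>n. \<sigma> n (c n)) \<circ> s) n) (frontier \<Omega>)) \<longlonglongrightarrow> infdist q' (frontier \<Omega>)"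
        by (intro tendsto_intros s)
      moreover have "(\<lambda>n. infdist (((\<lambda>n. \<sigma> n (c n)) \<circ> s) n) (frontier \<Omega>)) \<longlonglongrightarrow> 0"
      proof (rule tendsto_sandwich[OF _ _ tendsto_const inv0])
        show "eventually (\<lambda>n. infdist (((\<lambda>n. \<sigma> n (c n)) \<circ> s) n) (frontier \<Omega>) \<le> 1 / real (Suc (s n))) sequentially"
          using small[OF c(1)] by (intro always_eventually allI) (simp add: bdist_def less_imp_le)
      qed (simp add: infdist_nonneg)
      ultimately have "infdist q' (frontier \<Omega>) = 0" by (rule LIMSEQ_unique)
      then show ?thesis using p in_closed_iff_infdist_zero[of "frontier \<Omega>" q'] by auto
    qed
    with \<open>q' \<notin> E\<close> obtain U z0 f r0 where U: "open U" "q' \<in> U" "z0 \<in> \<Omega>"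
      and f: "f differentiable_on {0<..}" "continuous_on {0<..} (deriv f)"
        "strict_mono_on {0<..} f" "filterlim f at_top at_top"
      and kf: "\<And>z. z \<in> \<Omega> \<inter> U \<Longrightarrow> kobayashi_dist \<Omega> z0 z \<le> f (1 / bdist \<Omega> z)"
      and M: "(M_fun \<Omega> U \<longlongrightarrow> 0) (at_right 0)"
      and r0: "r0 > 0" "(\<integral>\<^sup>+ r\<in>{0<..<r0}. ennreal (M_fun \<Omega> U r / r\<^sup>2 * deriv f (1 / r)) \<partial>lborel) < \<infinity>"
      using assms(8)[of q'] by blast
    have "q' \<noteq> q" using \<open>dist p' q' = r\<close> p'(2) cl by auto
    obtain \<rho>' where \<rho>': "\<rho>' > 0" "cball q' \<rho>' \<subseteq> U" using U open_contains_cball by blast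
    \<comment> \<open>The half distance to \<open>q\<close> forces the final points
      \<open>\<sigma> n (b n)\<close> out of the open ball of radius \<open>\<rho>\<close> about
      \<open>q'\<close> once \<open>d / Suc n < \<rho>\<close>.\<close>
    define \<rho> where "\<rho> = min \<rho>' (dist q' q / 2)"
    have \<rho>: "\<rho> > 0" "cball q' \<rho> \<subseteq> U" "\<rho> \<le> dist q' q / 2"
      using \<rho>' \<open>q' \<noteq> q\<close> by (auto simp: \<rho>_def)
    \<comment> \<open>The arc will start within \<open>\<rho> / 2\<close> of \<open>q'\<close> and
      end at distance \<open>\<rho>\<close>, so a displacement below \<open>\<rho> / 2\<close> is
      contradictory.\<close>
    have "\<rho> / 2 > 0" using \<rho> by simp
    from local_visibility[OF assms(1,2,4) U(1,2) \<open>q' \<in> frontier \<Omega>\<close> U(3) f kf M r0 L this]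
    obtain \<eta> where \<eta>: "\<eta> > 0" "\<And>a b \<sigma>. a \<le> b \<Longrightarrow> almost_geodesic \<Omega> L \<kappa> {a..b} \<sigma> \<Longrightarrow> \<sigma> ` {a..b} \<subseteq> U \<Longrightarrow>
      (\<And>t. t \<in> {a..b} \<Longrightarrow> bdist \<Omega> (\<sigma> t) < \<eta>) \<Longrightarrow> norm (\<sigma> b - \<sigma> a) < \<rho> / 2"
      by blast
    have "eventually (\<lambda>n. 1 / real (Suc (s n)) < min \<eta> (\<rho> / d)) sequentially"
      using inv0 by (rule order_tendstoD) (use \<eta> \<rho> d in simp)
    moreover have "eventually (\<lambda>n. dist (((\<lambda>n. \<sigma> n (c n)) \<circ> s) n) q' < \<rho> / 2) sequentially"
      by (rule tendstoD[OF s(2)]) (use \<rho>(1) in simp)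
    ultimately have "eventually (\<lambda>n. 1 / real (Suc (s n)) < min \<eta> (\<rho> / d) \<and>
        dist (((\<lambda>n. \<sigma> n (c n)) \<circ> s) n) q' < \<rho> / 2) sequentially"
      by (rule eventually_conj)
    then obtain k where k: "1 / real (Suc (s k)) < min \<eta> (\<rho> / d)" "dist (\<sigma> (s k) (c (s k))) q' < \<rho> / 2"
      using eventually_happens[of _ sequentially] by auto
    define n where "n = s k"
    have n: "1 / real (Suc n) < \<eta>" "d / real (Suc n) < \<rho>" "dist q' (\<sigma> n (c n)) < \<rho> / 2"
    proof -
      show "1 / real (Suc n) < \<eta>" using k(1) by (simp add: n_def)
      show "dist q' (\<sigma> n (c n)) < \<rho> / 2" using k(2) by (simp add: n_def dist_commute)
      have "d * (1 / real (Suc n)) < d * (\<rho> / d)"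
        using k(1) d(1) by (intro mult_strict_left_mono) (auto simp: n_def)
      then show "d / real (Suc n) < \<rho>" using d(1) by simp
    qed
    have cn: "a n \<le> c n" "c n \<le> b n" using c(1)[of n] by auto
    have "continuous_on {c n..b n} (\<lambda>t. dist q' (\<sigma> n t))"
      using cn by (intro continuous_intros continuous_on_subset[OF cont[of n]]) auto
    moreover have "dist q' (\<sigma> n (c n)) \<le> \<rho>" using n(3) \<rho>(1) by linarith
    moreover have "\<rho> \<le> dist q' (\<sigma> n (b n))"
      using \<sigma>b[of n] n(2) \<rho>(3) dist_triangle2[of q' q "\<sigma> n (b n)"] by simp
    \<comment> \<open>Up to this first exit the arc stays in \<open>cball q' \<rho>\<close>, hence
      in \<open>U\<close>, where the local estimate applies.\<close>
    ultimately obtain e where e: "e \<in> {c n..b n}" "dist q' (\<sigma> n e) = \<rho>"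
      "\<And>t. t \<in> {c n..e} \<Longrightarrow> dist q' (\<sigma> n t) \<le> \<rho>"
      using first_exit[of "c n" "b n" "\<lambda>t. dist q' (\<sigma> n t)" \<rho>] cn(2) by metis
    have "norm (\<sigma> n e - \<sigma> n (c n)) < \<rho> / 2"
    proof (rule \<eta>(2))
      show "c n \<le> e" using e by simp
      show "almost_geodesic \<Omega> L \<kappa> {c n..e} (\<sigma> n)"
        by (rule almost_geodesic_subinterval[OF ag[of n] cn(1)]) (use e in simp)
      show "\<sigma> n ` {c n..e} \<subseteq> U" using e(3) \<rho>(2) by auto
      show "bdist \<Omega> (\<sigma> n t) < \<eta>" if "t \<in> {c n..e}" for t
        using small[of t n] that e(1) cn n(1) by force
    qed
    then have "dist q' (\<sigma> n e) < \<rho>"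
      using n(3) dist_triangle[of q' "\<sigma> n e" "\<sigma> n (c n)"] by (simp add: dist_norm norm_minus_commute)
    then show False using e(2) by simp
  qed
qed

end
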